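(* Let $T\subset\mathbb{R}^3$ be a convex polyhedron satisfying the assumptions in the context, and suppose that $T$ is of at least one of the following types: Type I: $\mathcal{E}_I=\emptyset$; Type II: there is a point $\mathbf{x}_c$ (a center) such that for each vertex $\mathbf{v}_i$, $1\le i\le n$, $$(\mathbf{x}_c-\mathbf{v}_i)\times\sum_{j,\,e_{ij}\in\mathcal{E}}\boldsymbol{\tau}_{ij}=\mathbf{0}.$$ Then $\mathcal{P}_1^-\Lambda^k(T)\subseteq\mathcal{M}\Lambda^k(T)$ for $k=1,2$.
   Context: $T\subset\mathbb{R}^3$ is a (closed) convex polyhedron with vertices $\mathbf{v}_1,\dots,\mathbf{v}_n$. Generalized barycentric coordinates on $T$ are functions $\lambda_1,\dots,\lambda_n$ on $T$, non-negative, with $L(\mathbf{x})=\sum_i L(\mathbf{v}_i)\lambda_i(\mathbf{x})$ for every affine $L$ and all $\mathbf{x}\in T$. Assumption 1: $\lambda_i(\mathbf{v}_j)=\delta_{ij}$; $\lambda_i\in C^1(T)$ (up to the boundary); on each face $f$, the $\lambda_i$ with $\mathbf{v}_i\in f$ restrict to 2D generalized barycentric coordinates of the polygon $f$ which again satisfy the Lagrange property, are $C^1$ on $f$ and are linear on each edge of $f$, while $\lambda_i|_f=0$ if $\mathbf{v}_i\notin f$. Assumption 2: every face $f$ is a triangle or a parallelogram, and if its vertices are $\mathbf{v}_{i_1},\mathbf{v}_{i_2},\dots$ in counterclockwise order seen from outside $T$, $D_{ab}:=(\nabla\lambda_{i_a}\times\nabla\lambda_{i_b})\cdot\mathbf{n}_f|_f$,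 and $|f|$ is the area, then $D_{12}=D_{23}=D_{31}=\frac1{2|f|}$ for a triangle, and $D_{12}+D_{34}=D_{23}+D_{41}=\frac1{|f|}$ for a parallelogram. Here $\mathbf{n}_f$ is the unit outward normal on $f$. Whitney 1-forms: $W_{ij}=\lambda_i\nabla\lambda_j-\lambda_j\nabla\lambda_i$; $\mathrm{curl}\,W_{ij}=2\nabla\lambda_i\times\nabla\lambda_j$. For $i\ne j$, $e_{ij}$ is the directed segment from $\mathbf{v}_i$ to $\mathbf{v}_j$ and $\boldsymbol{\tau}_{ij}=\mathbf{v}_j-\mathbf{v}_i$. $\mathcal{E}$ is the set of $e_{ij}$ that are edges of $T$ (both directions included), $\mathcal{E}_F$ the set of $e_{ij}$ lying on $\partial T$ but not in $\mathcal{E}$, $\mathcal{E}_I$ the set of remaining $e_{ij}$ (not lying on $\partial T$). For $e_{ij}\in\mathcal{E}$, $\mathcal{V}_{ij}$ is the set of all vertices of the two faces sharing $e_{ij}$. For each $e_{ik}\in\mathcal{E}_I$ fix once and for all coefficients $C^{ik}_{ij}$ with $\boldsymbol{\tau}_{ik}=\sum_{j,\,e_{ij}\in\mathcal{E}}C^{ik}_{ij}\boldsymbol{\tau}_{ij}$. For $e_{ij}\in\mathcal{E}$ define $$\tilde W_{ij}=W_{ij}+\tfrac12\Big(\sum_{\mathbf{v}_k\in\mathcal{V}_{ij},\,e_{ik}\in\mathcal{E}_F}W_{ik}-\sum_{\mathbf{v}_k\in\mathcal{V}_{ij},\,e_{jk}\in\mathcal{E}_F}W_{jk}\Big)+\tfrac12\Big(\sum_{k,\,e_{ik}\in\mathcal{E}_I}C^{ik}_{ij}W_{ik}-\sum_{k,\,e_{jk}\in\mathcal{E}_I}C^{jk}_{ji}W_{jk}\Big).$$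 $\mathcal{F}$ is the set of faces of $T$; $\partial f$ is the boundary of $f$ oriented by the right-hand rule with $\mathbf{n}_f$; $e_{ij}\in\partial f$ means that $e_{ij}$ is an edge of $f$ directed according to this orientation. Define $\tilde W_f=\sum_{e_{ij}\in\partial f}\tilde W_{ij}$ and, for a fixed point $\mathbf{x}_*$ in the interior of $T$, $$\mathcal{M}\Lambda^1(T)=\mathrm{span}\{\nabla\lambda_i,\ 1\le i\le n\}+\mathrm{span}\{\tilde W_f,\ f\in\mathcal{F}\},$$ $$\mathcal{M}\Lambda^2(T)=\mathrm{span}\{\mathrm{curl}\,\tilde W_f,\ f\in\mathcal{F}\}+\mathrm{span}\{\mathbf{x}-\mathbf{x}_*\}.$$ The lowest-order Nédélec-Raviart-Thomas spaces are $$\mathcal{P}_1^-\Lambda^1(T)=\{\mathbf{a}\times\mathbf{x}+\mathbf{b}:\ \mathbf{a},\mathbf{b}\in\mathbb{R}^3\},\qquad \mathcal{P}_1^-\Lambda^2(T)=\{a\mathbf{x}+\mathbf{c}:\ a\in\mathbb{R},\ \mathbf{c}\in\mathbb{R}^3\}.$$ *)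

theory Defs
  imports "HOL-Analysis.Analysis" "HOL-Library.Function_Algebras"
begin

type_synonym field = "real^3 \<Rightarrow> real^3"

section \<open>Calculus up to the boundary\<close>

text \<open>Gradients are taken relative to a set, so that they also make sense at boundary points.
  On a convex set with nonempty interior the gradient is unique at every point. The predicate
  \<open>C1_on\<close> does not need uniqueness and is also used on two-dimensional faces, where only
  the tangential part of \<open>G\<close> matters.\<close>

definition grad :: "(real^3) set \<Rightarrow> (real^3 \<Rightarrow> real) \<Rightarrow> field" where
  "grad S g x = (THE D. (g has_derivative (\<lambda>h. D \<bullet> h)) (at x within S))"

definition C1_on :: "(real^3) set \<Rightarrow> (real^3 \<Rightarrow> real) \<Rightarrow> bool" where
  "C1_on S g \<longleftrightarrow> (\<exists>G::field. continuous_on S G \<and>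
     (\<forall>x\<in>S. (g has_derivative (\<lambda>h. G x \<bullet> h)) (at x within S)))"

definition curl :: "field \<Rightarrow> field" where
  "curl \<phi> x = (let d = (\<lambda>k l. grad UNIV (\<lambda>y. \<phi> y $ k) x $ l) in
     vector [d 3 2 - d 2 3, d 1 3 - d 3 1, d 2 1 - d 1 2])"

text \<open>Whitney forms built from \<open>C\<^sup>1\<close> functions need not be differentiable, so their curl is
  the distributional one: \<open>has_curl T u w\<close> says that the distributional curl of \<open>u\<close> in the
  interior of \<open>T\<close> is represented by \<open>w\<close>, continuous up to the boundary. Such a \<open>w\<close> is unique
  on \<open>T\<close> when \<open>T\<close> is the closure of its interior. For continuous \<open>u\<close> and \<open>w\<close>, compactly
  supported test fields of class \<open>C\<^sup>1\<close> and of class \<open>C\<^sup>\<infinity>\<close> give the same notion.\<close>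

definition test_field :: "(real^3) set \<Rightarrow> field \<Rightarrow> bool" where
  "test_field T \<phi> \<longleftrightarrow> (\<forall>k. C1_on UNIV (\<lambda>x. \<phi> x $ k)) \<and>
     (\<exists>K. compact K \<and> K \<subseteq> interior T \<and> (\<forall>x. x \<notin> K \<longrightarrow> \<phi> x = 0))"

definition has_curl :: "(real^3) set \<Rightarrow> field \<Rightarrow> field \<Rightarrow> bool" where
  "has_curl T u w \<longleftrightarrow> continuous_on T w \<and>
     (\<forall>\<phi>. test_field T \<phi> \<longrightarrow>
        integral T (\<lambda>x. u x \<bullet> curl \<phi> x) = integral T (\<lambda>x. w x \<bullet> \<phi> x))"

section \<open>Spaces of vector fields on a set\<close>

text \<open>A vector field on \<open>T\<close> is represented by its extension by zero, so that equality of
  representatives is equality on \<open>T\<close>.\<close>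

definition on_set :: "(real^3) set \<Rightarrow> field \<Rightarrow> field" where
  "on_set T u = (\<lambda>x. if x \<in> T then u x else 0)"

interpretation fields: vector_space "\<lambda>(c::real) (u::field) x. c *\<^sub>R u x"
  by unfold_locales (auto simp: fun_eq_iff algebra_simps)

section \<open>Convex polyhedra with numbered vertices\<close>

text \<open>The vertices are \<open>v 1, \<dots>, v n\<close>; the directed segment from \<open>v i\<close> to \<open>v j\<close> is
  represented by the pair \<open>(i, j)\<close>.\<close>

definition polyhedron_vertices :: "(real^3) set \<Rightarrow> nat \<Rightarrow> (nat \<Rightarrow> real^3) \<Rightarrow> bool" where
  "polyhedron_vertices T n v \<longleftrightarrow> polytope T \<and> interior T \<noteq> {} \<and>
     inj_on v {1..n} \<and> v ` {1..n} = {x. x extreme_point_of T}"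

definition faces :: "(real^3) set \<Rightarrow> (real^3) set set" where
  "faces T = {f. f facet_of T}"

definition face_verts :: "nat \<Rightarrow> (nat \<Rightarrow> real^3) \<Rightarrow> (real^3) set \<Rightarrow> nat set" where
  "face_verts n v f = {i\<in>{1..n}. v i \<in> f}"

definition outward_normal :: "(real^3) set \<Rightarrow> (real^3) set \<Rightarrow> real^3" where
  "outward_normal T f = (THE m. norm m = 1 \<and> (\<forall>x\<in>T. \<forall>y\<in>f. m \<bullet> (x - y) \<le> 0))"

text \<open>The area of a planar face is the volume of the prism of height one over it.\<close>

definition face_area :: "(real^3) set \<Rightarrow> (real^3) set \<Rightarrow> real" where
  "face_area T f = measure lebesgue {x + t *\<^sub>R outward_normal T f | x t. x \<in> f \<and> 0 \<le> t \<and> t \<le> 1}"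

definition segments :: "nat \<Rightarrow> (nat \<times> nat) set" where
  "segments n = {(i, j). i \<in> {1..n} \<and> j \<in> {1..n} \<and> i \<noteq> j}"

definition tau :: "(nat \<Rightarrow> real^3) \<Rightarrow> nat \<Rightarrow> nat \<Rightarrow> real^3" where
  "tau v i j = v j - v i"

definition edges :: "(real^3) set \<Rightarrow> nat \<Rightarrow> (nat \<Rightarrow> real^3) \<Rightarrow> (nat \<times> nat) set" where
  "edges T n v = {(i, j) \<in> segments n. closed_segment (v i) (v j) edge_of T}"

definition face_diagonals :: "(real^3) set \<Rightarrow> nat \<Rightarrow> (nat \<Rightarrow> real^3) \<Rightarrow> (nat \<times> nat) set" where
  "face_diagonals T n v =
     {(i, j) \<in> segments n. closed_segment (v i) (v j) \<subseteq> frontier T} - edges T n v"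

definition inner_diagonals :: "(real^3) set \<Rightarrow> nat \<Rightarrow> (nat \<Rightarrow> real^3) \<Rightarrow> (nat \<times> nat) set" where
  "inner_diagonals T n v = segments n - edges T n v - face_diagonals T n v"

definition edge_nbhd :: "(real^3) set \<Rightarrow> nat \<Rightarrow> (nat \<Rightarrow> real^3) \<Rightarrow> nat \<Rightarrow> nat \<Rightarrow> nat set" where
  "edge_nbhd T n v i j =
     (\<Union>f\<in>{f \<in> faces T. closed_segment (v i) (v j) \<subseteq> f}. face_verts n v f)"

text \<open>Right-hand rule: seen from outside, \<open>f\<close> lies to the left of each of its directed
  boundary edges.\<close>

definition face_bdry ::
  "(real^3) set \<Rightarrow> nat \<Rightarrow> (nat \<Rightarrow> real^3) \<Rightarrow> (real^3) set \<Rightarrow> (nat \<times> nat) set" where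
  "face_bdry T n v f = {(i, j) \<in> edges T n v. closed_segment (v i) (v j) \<subseteq> f \<and>
     (\<forall>x\<in>f. 0 \<le> cross3 (tau v i j) (x - v i) \<bullet> outward_normal T f)}"

definition ccw_order ::
  "(real^3) set \<Rightarrow> nat \<Rightarrow> (nat \<Rightarrow> real^3) \<Rightarrow> (real^3) set \<Rightarrow> nat list \<Rightarrow> bool" where
  "ccw_order T n v f is \<longleftrightarrow> distinct is \<and> set is = face_verts n v f \<and>
     (\<forall>a<length is. (is ! a, is ! (Suc a mod length is)) \<in> face_bdry T n v f)"

section \<open>Generalized barycentric coordinates and the two assumptions\<close>

definition gbc ::
  "(real^3) set \<Rightarrow> nat set \<Rightarrow> (nat \<Rightarrow> real^3) \<Rightarrow> (nat \<Rightarrow> real^3 \<Rightarrow> real) \<Rightarrow> bool" where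
  "gbc P I v lam \<longleftrightarrow> (\<forall>i\<in>I. \<forall>x\<in>P. 0 \<le> lam i x) \<and>
     (\<forall>a b. \<forall>x\<in>P. a \<bullet> x + b = (\<Sum>i\<in>I. (a \<bullet> v i + b) * lam i x))"

definition lagrange :: "nat set \<Rightarrow> (nat \<Rightarrow> real^3) \<Rightarrow> (nat \<Rightarrow> real^3 \<Rightarrow> real) \<Rightarrow> bool" where
  "lagrange I v lam \<longleftrightarrow> (\<forall>i\<in>I. \<forall>j\<in>I. lam i (v j) = (if i = j then 1 else 0))"

definition assumption1 ::
  "(real^3) set \<Rightarrow> nat \<Rightarrow> (nat \<Rightarrow> real^3) \<Rightarrow> (nat \<Rightarrow> real^3 \<Rightarrow> real) \<Rightarrow> bool" where
  "assumption1 T n v lam \<longleftrightarrow>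
     lagrange {1..n} v lam \<and> (\<forall>i\<in>{1..n}. C1_on T (lam i)) \<and>
     (\<forall>f\<in>faces T.
        gbc f (face_verts n v f) v lam \<and> lagrange (face_verts n v f) v lam \<and>
        (\<forall>i\<in>face_verts n v f. C1_on f (lam i) \<and>
           (\<forall>e. e edge_of f \<longrightarrow> (\<exists>a b. \<forall>x\<in>e. lam i x = a \<bullet> x + b))) \<and>
        (\<forall>i\<in>{1..n} - face_verts n v f. \<forall>x\<in>f. lam i x = 0))"

definition face_det ::
  "(real^3) set \<Rightarrow> (nat \<Rightarrow> real^3 \<Rightarrow> real) \<Rightarrow> (real^3) set \<Rightarrow> nat \<Rightarrow> nat \<Rightarrow> real^3 \<Rightarrow> real" where
  "face_det T lam f i j x =
     cross3 (grad T (lam i) x) (grad T (lam j) x) \<bullet> outward_normal T f"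

definition assumption2 ::
  "(real^3) set \<Rightarrow> nat \<Rightarrow> (nat \<Rightarrow> real^3) \<Rightarrow> (nat \<Rightarrow> real^3 \<Rightarrow> real) \<Rightarrow> bool" where
  "assumption2 T n v lam \<longleftrightarrow> (\<forall>f\<in>faces T. let D = face_det T lam f; A = face_area T f in
     ((\<exists>i j k. ccw_order T n v f [i, j, k]) \<or>
      (\<exists>i j k l. ccw_order T n v f [i, j, k, l] \<and> tau v i j = tau v l k)) \<and>
     (\<forall>i j k. ccw_order T n v f [i, j, k] \<longrightarrow>
        (\<forall>x\<in>f. D i j x = 1 / (2 * A) \<and> D j k x = 1 / (2 * A) \<and> D k i x = 1 / (2 * A))) \<and>
     (\<forall>i j k l. ccw_order T n v f [i, j, k, l] \<longrightarrow>
        (\<forall>x\<in>f. D i j x + D k l x = 1 / A \<and> D j k x + D l i x = 1 / A)))"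

section \<open>Whitney forms and the finite element spaces\<close>

definition whitney ::
  "(real^3) set \<Rightarrow> (nat \<Rightarrow> real^3 \<Rightarrow> real) \<Rightarrow> nat \<Rightarrow> nat \<Rightarrow> field" where
  "whitney T lam i j x = lam i x *\<^sub>R grad T (lam j) x - lam j x *\<^sub>R grad T (lam i) x"

text \<open>\<open>C i k j\<close> is the coefficient of \<open>\<tau>\<^sub>i\<^sub>j\<close> in the chosen representation of \<open>\<tau>\<^sub>i\<^sub>k\<close>.\<close>

definition diagonal_coeffs ::
  "(real^3) set \<Rightarrow> nat \<Rightarrow> (nat \<Rightarrow> real^3) \<Rightarrow> (nat \<Rightarrow> nat \<Rightarrow> nat \<Rightarrow> real) \<Rightarrow> bool" where
  "diagonal_coeffs T n v C \<longleftrightarrow> (\<forall>(i, k) \<in> inner_diagonals T n v.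
     tau v i k = (\<Sum>j | (i, j) \<in> edges T n v. C i k j *\<^sub>R tau v i j))"

definition whitney_edge ::
  "(real^3) set \<Rightarrow> nat \<Rightarrow> (nat \<Rightarrow> real^3) \<Rightarrow> (nat \<Rightarrow> real^3 \<Rightarrow> real) \<Rightarrow>
   (nat \<Rightarrow> nat \<Rightarrow> nat \<Rightarrow> real) \<Rightarrow> nat \<Rightarrow> nat \<Rightarrow> field" where
  "whitney_edge T n v lam C i j x =
     whitney T lam i j x
     + (1/2) *\<^sub>R
        ((\<Sum>k | k \<in> edge_nbhd T n v i j \<and> (i, k) \<in> face_diagonals T n v. whitney T lam i k x)
       - (\<Sum>k | k \<in> edge_nbhd T n v i j \<and> (j, k) \<in> face_diagonals T n v. whitney T lam j k x))
     + (1/2) *\<^sub>R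
        ((\<Sum>k | (i, k) \<in> inner_diagonals T n v. C i k j *\<^sub>R whitney T lam i k x)
       - (\<Sum>k | (j, k) \<in> inner_diagonals T n v. C j k i *\<^sub>R whitney T lam j k x))"

definition whitney_face ::
  "(real^3) set \<Rightarrow> nat \<Rightarrow> (nat \<Rightarrow> real^3) \<Rightarrow> (nat \<Rightarrow> real^3 \<Rightarrow> real) \<Rightarrow>
   (nat \<Rightarrow> nat \<Rightarrow> nat \<Rightarrow> real) \<Rightarrow> (real^3) set \<Rightarrow> field" where
  "whitney_face T n v lam C f x =
     (\<Sum>(i, j)\<in>face_bdry T n v f. whitney_edge T n v lam C i j x)"

definition M1 ::
  "(real^3) set \<Rightarrow> nat \<Rightarrow> (nat \<Rightarrow> real^3) \<Rightarrow> (nat \<Rightarrow> real^3 \<Rightarrow> real) \<Rightarrow>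
   (nat \<Rightarrow> nat \<Rightarrow> nat \<Rightarrow> real) \<Rightarrow> field set" where
  "M1 T n v lam C = {u + w | u w.
     u \<in> fields.span {on_set T (grad T (lam i)) | i. i \<in> {1..n}} \<and>
     w \<in> fields.span {on_set T (whitney_face T n v lam C f) | f. f \<in> faces T}}"

definition M2 ::
  "(real^3) set \<Rightarrow> nat \<Rightarrow> (nat \<Rightarrow> real^3) \<Rightarrow> (nat \<Rightarrow> real^3 \<Rightarrow> real) \<Rightarrow>
   (nat \<Rightarrow> nat \<Rightarrow> nat \<Rightarrow> real) \<Rightarrow> real^3 \<Rightarrow> field set" where
  "M2 T n v lam C xs = {u + w | u w.
     u \<in> fields.span {on_set T c | c f. f \<in> faces T \<and> has_curl T (whitney_face T n v lam C f) c} \<and>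
     w \<in> fields.span {on_set T (\<lambda>x. x - xs)}}"

text \<open>The lowest-order Nedelec space (\<open>P1\<close>, 1-forms) and Raviart-Thomas space (\<open>P2\<close>, 2-forms);
  the digit is the degree of the forms, as in \<open>M1\<close> and \<open>M2\<close>.\<close>

definition P1 :: "(real^3) set \<Rightarrow> field set" where
  "P1 T = {on_set T (\<lambda>x. cross3 a x + b) | a b. True}"

definition P2 :: "(real^3) set \<Rightarrow> field set" where
  "P2 T = {on_set T (\<lambda>x. a *\<^sub>R x + c) | a c. True}"

end

theory Submission
  imports Defs
begin

text \<open>For an antisymmetric array \<open>W\<^sub>i\<^sub>k\<close> and the weights \<open>c\<^sub>i\<^sub>k = a \<bullet> ((v\<^sub>i - o) \<times> (v\<^sub>k - o))\<close>, expressing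
  diagonals through edge vectors turns the sum of \<open>c\<^sub>i\<^sub>k W\<^sub>i\<^sub>k\<close> over all pairs into the sum of
  \<open>c\<^sub>i\<^sub>j\<close> times the combined array over the edges. For Whitney forms the former sum is
  \<open>2 a \<times> (x - o)\<close>, for their curls it is \<open>4 a\<close>.

  The edge chain \<open>c\<close> is the sum of a combination of facet boundaries and a chain orthogonal to
  all of them. The latter is a closed cochain on a polyhedral sphere, hence the coboundary of a
  vertex potential \<open>p\<close>. For type II with \<open>o = x\<^sub>c\<close> the chain \<open>c\<close> is divergence free, so this
  part vanishes. For type I the combined forms around a vertex \<open>j\<close> add up to
  \<open>\<nabla>\<lambda>\<^sub>j\<close>, so it contributes only gradients, whose curl is zero.\<close>

section \<open>Facets, edges and vertices of the polyhedron\<close>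

text \<open>The weights come from affine reproduction: summing c_ik times the gradient of the k-th
  coordinate over k gives a x (v_i - o), and averaging this with the coordinates of x gives a x (x -
  o). They suit the edge forms because c_ik = a . ((v_i - o) x tau_ik) is, for fixed i, linear in
  tau_ik, and by antisymmetry the same holds at the other end. A diagonal can thus be resolved into
  edge vectors at either end, and the factors 1/2 in the edge forms average the two ways. By the
  same formula the divergence of the chain at v_i is, up to sign, the pairing of a with (v_i - o) x
  (sum of the edge vectors at v_i), which the center condition makes zero; a divergence-free chain
  is orthogonal to coboundaries. Two obstacles shape the proof. Exactness of closed cochains is a
  topological fact, derived here from convexity by a height function. And the coordinates are only
  C^1, so that the curl of a gradient cannot be seen to vanish by commuting second derivatives; a
  weak form of this is proved with difference quotients.\<close>

lemma perp_both_imp_parallel_cross3: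
  fixes m a b :: "real^3"
  assumes "m \<bullet> a = 0" "m \<bullet> b = 0"
  shows "(m \<bullet> m) *\<^sub>R cross3 a b = (m \<bullet> cross3 a b) *\<^sub>R m"
proof -
  have "cross3 m (cross3 a b) = 0"
    using assms by (simp add: Lagrange)
  then have "cross3 m (cross3 m (cross3 a b)) = 0"
    by (metis cross_zero_right)
  then show ?thesis
    by (simp only: Lagrange[of m m]) simp
qed

lemma cross3_eq_0_imp_multiple:
  fixes a b :: "real^3"
  assumes "cross3 a b = 0" "a \<noteq> 0"
  shows "b = (a \<bullet> b / (a \<bullet> a)) *\<^sub>R a"
proof -
  have "cross3 a (cross3 a b) = 0"
    using assms by simp
  then have "(a \<bullet> a) *\<^sub>R b = (a \<bullet> b) *\<^sub>R a"
    by (simp add: Lagrange)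
  then have "(1 / (a \<bullet> a)) *\<^sub>R ((a \<bullet> a) *\<^sub>R b) = (1 / (a \<bullet> a)) *\<^sub>R ((a \<bullet> b) *\<^sub>R a)"
    by simp
  then show ?thesis
    using assms(2) by simp
qed

text \<open>Finitely many hyperplanes through the origin form a null set and cannot cover a nonempty
  open set. This supplies general position for the height function and for the cutting plane at a
  vertex.\<close>

lemma generic_vector_in_open:
  fixes U :: "'a::euclidean_space set"
  assumes "open U" "U \<noteq> {}" "finite N" "0 \<notin> N"
  obtains p where "p \<in> U" "\<And>u. u \<in> N \<Longrightarrow> p \<bullet> u \<noteq> 0"
proof -
  have "negligible (\<Union>u\<in>N. {x. u \<bullet> x = 0})"
  proof (rule negligible_Union)
    show "finite ((\<lambda>u. {x. u \<bullet> x = 0}) ` N)"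
      using assms by simp
    show "negligible S" if "S \<in> (\<lambda>u. {x. u \<bullet> x = 0}) ` N" for S
    proof -
      from that obtain u where u: "u \<in> N" "S = {x. u \<bullet> x = 0}"
        by auto
      then have "u \<noteq> 0"
        using assms by auto
      then show ?thesis
        using u negligible_hyperplane[of u 0] by simp
    qed
  qed
  then have "\<not> U \<subseteq> (\<Union>u\<in>N. {x. u \<bullet> x = 0})"
    using open_not_negligible[OF assms(1,2)] negligible_subset by blast
  then obtain p where "p \<in> U" "\<And>u. u \<in> N \<Longrightarrow> u \<bullet> p \<noteq> 0"
    by auto
  then show ?thesis
    using that by (metis inner_commute)
qed

lemma finite_segments: "finite (segments n)"
  by (rule finite_subset[of _ "{1..n} \<times> {1..n}"]) (auto simp: segments_def)

lemma edges_subset_segments: "edges T n v \<subseteq> segments n"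
  by (auto simp: edges_def)

lemma finite_edges: "finite (edges T n v)"
  using finite_subset[OF edges_subset_segments finite_segments] .

lemma edges_sym: "(i, j) \<in> edges T n v \<longleftrightarrow> (j, i) \<in> edges T n v"
  by (auto simp: edges_def segments_def closed_segment_commute)

lemma face_diagonals_sym: "(i, j) \<in> face_diagonals T n v \<longleftrightarrow> (j, i) \<in> face_diagonals T n v"
  using edges_sym[of i j T n v] by (auto simp: face_diagonals_def segments_def closed_segment_commute)

locale tri_par_polyhedron =
  fixes T :: "(real^3) set" and n :: nat and v :: "nat \<Rightarrow> real^3"
  assumes vertices: "polyhedron_vertices T n v"
    and face_shape: "f \<in> faces T \<Longrightarrow> (\<exists>i j k. ccw_order T n v f [i, j, k]) \<or>
      (\<exists>i j k l. ccw_order T n v f [i, j, k, l] \<and> tau v i j = tau v l k)"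
begin

lemma polytope: "polytope T" and interior_ne: "interior T \<noteq> {}"
  and inj_v: "inj_on v {1..n}" and extreme_set: "v ` {1..n} = {x. x extreme_point_of T}"
  using vertices by (auto simp: polyhedron_vertices_def)

lemma polyhedron: "polyhedron T" and convex: "convex T" and compact: "compact T"
  using polytope polytope_imp_polyhedron polytope_imp_convex polytope_imp_compact by auto

lemma aff_dim_T: "aff_dim T = 3"
  using aff_dim_nonempty_interior[OF interior_ne] by simp

lemma vertex_extreme: "i \<in> {1..n} \<Longrightarrow> v i extreme_point_of T"
  using extreme_set by blast

lemma vertex_in: "i \<in> {1..n} \<Longrightarrow> v i \<in> T"
  using vertex_extreme by (auto simp: extreme_point_of_def)

lemma v_eq_iff: "i \<in> {1..n} \<Longrightarrow> j \<in> {1..n} \<Longrightarrow> v i = v j \<longleftrightarrow> i = j"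
  by (rule inj_on_eq_iff[OF inj_v])

lemma vertex_in_segment:
  assumes "i \<in> {1..n}" "a \<in> T" "b \<in> T" "v i \<in> closed_segment a b"
  shows "v i = a \<or> v i = b"
proof -
  have "v i \<notin> open_segment a b"
    using vertex_extreme[OF assms(1)] assms(2,3) unfolding extreme_point_of_def by blast
  then show ?thesis
    using assms(4) by (simp add: open_segment_def)
qed

lemma edgeD:
  assumes "(i, j) \<in> edges T n v"
  shows "i \<in> {1..n}" "j \<in> {1..n}" "i \<noteq> j" "closed_segment (v i) (v j) face_of T"
    "aff_dim (closed_segment (v i) (v j)) = 1"
  using assms by (auto simp: edges_def segments_def edge_of_def)

text \<open>A one-dimensional face is compact, convex and collinear, hence a segment. Vertices of T
  that lie in it are extreme in it, so the two given ones are its ends.\<close>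

lemma line_face_eq_segment:
  assumes e: "e face_of T" "aff_dim e = 1" and ij: "i \<in> {1..n}" "j \<in> {1..n}" "i \<noteq> j"
    and "v i \<in> e" "v j \<in> e"
  shows "e = closed_segment (v i) (v j)"
proof -
  have "collinear e" "compact e" "convex e" "e \<noteq> {}"
    using e assms by (auto simp: collinear_aff_dim intro: face_of_imp_compact[OF convex compact] face_of_imp_convex)
  then obtain a b where ab: "e = closed_segment a b"
    using compact_convex_collinear_segment by blast
  have "v i extreme_point_of e" "v j extreme_point_of e"
    using extreme_point_of_face[OF e(1)] vertex_extreme assms by auto
  then have "v i = a \<or> v i = b" "v j = a \<or> v j = b"
    unfolding ab by (auto simp: extreme_point_of_segment)
  then show ?thesis
    using ab v_eq_iff ij by (auto simp: closed_segment_commute)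
qed

lemma facesD:
  assumes "f \<in> faces T"
  shows "f face_of T" "f \<subseteq> T" "aff_dim f = 2" "convex f"
  using assms aff_dim_T by (auto simp: faces_def facet_of_def face_of_imp_subset face_of_imp_convex)

text \<open>The intersection is a proper face of each facet, so its dimension is below 2, and two
  distinct vertices in it make the dimension at least 1.\<close>

lemma facets_meet_in_edge:
  assumes f: "f \<in> faces T" "g \<in> faces T" "f \<noteq> g" and ij: "i \<in> {1..n}" "j \<in> {1..n}" "i \<noteq> j"
    and "v i \<in> f \<inter> g" "v j \<in> f \<inter> g"
  shows "(i, j) \<in> edges T n v" "f \<inter> g = closed_segment (v i) (v j)"
proof -
  have face: "f \<inter> g face_of T"
    using f facesD by (auto intro: face_of_Int)
  have "f \<inter> g \<noteq> f"
  proof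
    assume "f \<inter> g = f"
    then have "f face_of g"
      using face_of_face[OF facesD(1)[OF f(2)]] facesD f by auto
    then have "aff_dim f < aff_dim g"
      using face_of_aff_dim_lt facesD f by blast
    then show False
      using facesD f by simp
  qed
  moreover have "f \<inter> g face_of f"
    using face face_of_face[OF facesD(1)[OF f(1)]] by auto
  ultimately have lt: "aff_dim (f \<inter> g) < 2"
    using face_of_aff_dim_lt facesD f by metis
  have "aff_dim {v i, v j} \<le> aff_dim (f \<inter> g)"
    by (rule aff_dim_subset) (use assms in auto)
  then have dim: "aff_dim (f \<inter> g) = 1"
    using lt ij v_eq_iff by (simp add: aff_dim_2 split: if_splits)
  show eq: "f \<inter> g = closed_segment (v i) (v j)"
    using line_face_eq_segment[OF face dim ij] assms by auto
  show "(i, j) \<in> edges T n v"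
    using eq face dim ij by (auto simp: edges_def segments_def edge_of_def)
qed

text \<open>An edge is the intersection of the facets containing it; with a single such facet it
  would be two-dimensional.\<close>

lemma edge_two_facets:
  assumes "(i, j) \<in> edges T n v"
  obtains f g where "f \<in> faces T" "g \<in> faces T" "f \<noteq> g" "v i \<in> f" "v j \<in> f" "v i \<in> g" "v j \<in> g"
proof -
  let ?e = "closed_segment (v i) (v j)"
  note e = edgeD[OF assms]
  have "?e \<noteq> T"
    using e(5) aff_dim_T by auto
  then have eq: "?e = \<Inter>{F. F facet_of T \<and> ?e \<subseteq> F}"
    using face_of_polyhedron[OF polyhedron e(4)] by simp
  have "?e \<noteq> {}"
    by simp
  then obtain f where f: "f facet_of T" "?e \<subseteq> f"
    using face_of_polyhedron_subset_facet[OF polyhedron e(4) _ \<open>?e \<noteq> T\<close>] by blast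
  have "\<exists>g. g facet_of T \<and> ?e \<subseteq> g \<and> g \<noteq> f"
  proof (rule ccontr)
    assume "\<not> ?thesis"
    then have one: "{F. F facet_of T \<and> ?e \<subseteq> F} = {f}"
      using f by blast
    have "?e = \<Inter>{f}"
      using eq unfolding one .
    then have "?e = f"
      by simp
    then show False
      using e(5) f(1) aff_dim_T by (simp add: facet_of_def)
  qed
  then obtain g where "g facet_of T" "?e \<subseteq> g" "g \<noteq> f"
    by blast
  moreover have "v i \<in> ?e" "v j \<in> ?e"
    by simp_all
  ultimately show ?thesis
    using that[of f g] f unfolding faces_def by blast
qed

text \<open>The facets cover the frontier, and a face that contains an inner point of a segment of T
  contains both ends. So the facet through the midpoint will do.\<close>

lemma frontier_segment_in_facet:
  assumes "closed_segment a b \<subseteq> frontier T" "a \<noteq> b"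
  obtains f where "f \<in> faces T" "a \<in> f" "b \<in> f"
proof -
  have "rel_frontier T = frontier T"
    by (rule rel_frontier_nonempty_interior[OF interior_ne])
  then have fr: "frontier T = \<Union> {F. F facet_of T}"
    using rel_frontier_of_polyhedron[OF polyhedron] by simp
  have mid: "midpoint a b \<in> open_segment a b"
    using assms(2) by (simp add: midpoint_in_open_segment)
  then have "midpoint a b \<in> frontier T"
    using assms(1) open_segment_eq_real_ivl segment_open_subset_closed by blast
  then obtain f where f: "f facet_of T" "midpoint a b \<in> f"
    using fr by auto
  moreover have "a \<in> T" "b \<in> T"
    using assms(1) frontier_subset_closed[OF compact_imp_closed[OF compact]] by auto
  ultimately show ?thesis
    using that face_ofD[of f T "midpoint a b" a b] mid by (auto simp: faces_def facet_of_def)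
qed

section \<open>Outward normals and the orientation of facet boundaries\<close>

lemma outward_normal_props:
  assumes f: "f \<in> faces T"
  shows "norm (outward_normal T f) = 1"
    and "x \<in> T \<Longrightarrow> y \<in> f \<Longrightarrow> outward_normal T f \<bullet> (x - y) \<le> 0"
    and "x \<in> T \<Longrightarrow> y \<in> f \<Longrightarrow> outward_normal T f \<bullet> (x - y) = 0 \<longleftrightarrow> x \<in> f"
proof -
  obtain a b where ab: "a \<noteq> 0" "T \<subseteq> {x. a \<bullet> x \<le> b}" "f = T \<inter> {x. a \<bullet> x = b}"
    using facet_of_polyhedron[OF polyhedron] f by (auto simp: faces_def)
  define m where "m = a /\<^sub>R norm a"
  have norm_m: "norm m = 1"
    using ab(1) by (simp add: m_def)
  have mdot: "m \<bullet> (x - y) = (a \<bullet> x - a \<bullet> y) / norm a" for x y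
    by (simp add: m_def inner_diff_right divide_simps)
  have m_le: "m \<bullet> (x - y) \<le> 0" if "x \<in> T" "y \<in> f" for x y
    using that ab by (auto simp: mdot divide_le_0_iff)
  have m_iff: "m \<bullet> (x - y) = 0 \<longleftrightarrow> x \<in> f" if "x \<in> T" "y \<in> f" for x y
    using that ab by (auto simp: mdot)
  \<comment> \<open>Any candidate is constant on f. If it were not parallel to m, then f would lie
    on a line of direction m x m'. So it is m up to sign, and a point of T off f fixes the
    sign.\<close>
  have uniq: "m' = m" if m': "norm m' = 1" "\<forall>x\<in>T. \<forall>y\<in>f. m' \<bullet> (x - y) \<le> 0" for m'
  proof -
    have perp: "m' \<bullet> (x - y) = 0" "m \<bullet> (x - y) = 0" if "x \<in> f" "y \<in> f" for x y
    proof -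
      have "x \<in> T" "y \<in> T"
        using that facesD[OF f] by auto
      then have "m' \<bullet> (x - y) \<le> 0" "m' \<bullet> (y - x) \<le> 0"
        using m'(2) that by blast+
      then show "m' \<bullet> (x - y) = 0"
        by (simp add: inner_diff_right)
      show "m \<bullet> (x - y) = 0"
        using m_iff that \<open>x \<in> T\<close> by blast
    qed
    obtain y where y: "y \<in> f"
      using facesD(3)[OF f] by fastforce
    have "\<not> collinear f"
      using facesD(3)[OF f] by (simp add: collinear_aff_dim)
    have "cross3 m m' = 0"
    proof (rule ccontr)
      assume ne: "cross3 m m' \<noteq> 0"
      let ?N = "cross3 m m'"
      have "\<exists>c. x - z = c *\<^sub>R ?N" if "x \<in> f" "z \<in> f" for x z
      proof -
        have "cross3 ?N (x - z) = 0"
          using perp that by (subst cross_skew) (simp add: Lagrange inner_commute)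
        then show ?thesis
          using cross3_eq_0_imp_multiple[OF _ ne] by blast
      qed
      then have "collinear f"
        unfolding collinear_def by blast
      then show False
        using \<open>\<not> collinear f\<close> by simp
    qed
    then obtain c where c: "m' = c *\<^sub>R m"
      using cross3_eq_0_imp_multiple[of m m'] norm_m by fastforce
    then have "\<bar>c\<bar> = 1"
      using m'(1) norm_m by simp
    have "f \<noteq> T"
      using facesD(3)[OF f] aff_dim_T by auto
    then have "\<exists>x\<in>T. x \<notin> f"
      using facesD(2)[OF f] by blast
    then obtain x where x: "x \<in> T" "x \<notin> f"
      by blast
    then have "m \<bullet> (x - y) < 0" "m' \<bullet> (x - y) \<le> 0"
      using m_le[of x y] m_iff[of x y] y m'(2) by auto
    then have "c \<ge> 0"
      unfolding c by (simp add: mult_le_0_iff)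
    then show ?thesis
      using \<open>\<bar>c\<bar> = 1\<close> c by simp
  qed
  have "outward_normal T f = m"
    unfolding outward_normal_def
  proof (rule the_equality)
    show "norm m = 1 \<and> (\<forall>x\<in>T. \<forall>y\<in>f. m \<bullet> (x - y) \<le> 0)"
      using norm_m m_le by blast
  qed (use uniq in blast)
  then show "norm (outward_normal T f) = 1"
    and "x \<in> T \<Longrightarrow> y \<in> f \<Longrightarrow> outward_normal T f \<bullet> (x - y) \<le> 0"
    and "x \<in> T \<Longrightarrow> y \<in> f \<Longrightarrow> outward_normal T f \<bullet> (x - y) = 0 \<longleftrightarrow> x \<in> f"
    using norm_m m_le m_iff by auto
qed

text \<open>If f lay on the left of both directions of an edge, it would be squeezed into the line
  of that edge.\<close>

lemma face_bdry_antisym: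
  assumes f: "f \<in> faces T" and ij: "(i, j) \<in> face_bdry T n v f"
  shows "(j, i) \<notin> face_bdry T n v f"
proof
  assume ji: "(j, i) \<in> face_bdry T n v f"
  let ?N = "outward_normal T f" and ?t = "tau v i j"
  have edge: "(i, j) \<in> edges T n v" and sub: "closed_segment (v i) (v j) \<subseteq> f"
    using ij by (simp_all add: face_bdry_def)
  note e = edgeD[OF edge]
  have "?t \<noteq> 0"
    using e v_eq_iff by (simp add: tau_def)
  have vf: "v i \<in> f" "v j \<in> f"
    using sub by auto
  have perp: "?N \<bullet> (x - y) = 0" if "x \<in> f" "y \<in> f" for x y
    using outward_normal_props(3)[OF f] that facesD[OF f] by blast
  have on_line: "\<exists>c. x - v i = c *\<^sub>R ?t" if x: "x \<in> f" for x
  proof -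
    have 1: "0 \<le> cross3 ?t (x - v i) \<bullet> ?N"
      using ij x by (simp add: face_bdry_def)
    have "0 \<le> cross3 (tau v j i) (x - v j) \<bullet> ?N"
      using ji x by (simp add: face_bdry_def)
    moreover have "cross3 (tau v j i) (x - v j) = - cross3 ?t (x - v i)"
      by (simp add: tau_def cross3_simps)
    ultimately have "cross3 ?t (x - v i) \<bullet> ?N = 0"
      using 1 by simp
    then have "(?N \<bullet> ?N) *\<^sub>R cross3 ?t (x - v i) = 0"
      using perp_both_imp_parallel_cross3[of ?N ?t "x - v i"] perp x vf by (simp add: tau_def inner_commute)
    then have "cross3 ?t (x - v i) = 0"
      using outward_normal_props(1)[OF f] by auto
    then show ?thesis
      using cross3_eq_0_imp_multiple \<open>?t \<noteq> 0\<close> by blast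
  qed
  have "collinear f"
    unfolding collinear_def
  proof (intro exI[of _ ?t] ballI)
    fix x y assume "x \<in> f" "y \<in> f"
    then obtain c d where "x - v i = c *\<^sub>R ?t" "y - v i = d *\<^sub>R ?t"
      using on_line by blast
    then have "x - y = (c - d) *\<^sub>R ?t"
      by (simp add: algebra_simps)
    then show "\<exists>c. x - y = c *\<^sub>R ?t" ..
  qed
  then show False
    using facesD(3)[OF f] by (simp add: collinear_aff_dim)
qed

section \<open>Facets as oriented triangles and parallelograms with a chosen first vertex\<close>

definition tri :: "(real^3) set \<Rightarrow> nat \<Rightarrow> nat \<Rightarrow> nat \<Rightarrow> bool" where
  "tri f i j k \<longleftrightarrow> distinct [i, j, k] \<and> face_verts n v f = {i, j, k} \<and>
     face_bdry T n v f = {(i, j), (j, k), (k, i)}"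

text \<open>The shape is recorded as a common midpoint of the diagonals, which is visibly stable
  under rotation of the four vertices.\<close>

definition par :: "(real^3) set \<Rightarrow> nat \<Rightarrow> nat \<Rightarrow> nat \<Rightarrow> nat \<Rightarrow> bool" where
  "par f i j k l \<longleftrightarrow> distinct [i, j, k, l] \<and> face_verts n v f = {i, j, k, l} \<and>
     face_bdry T n v f = {(i, j), (j, k), (k, l), (l, i)} \<and> v i + v k = v j + v l \<and>
     (i, k) \<notin> edges T n v \<and> (j, l) \<notin> edges T n v"

lemma tri_rotate: "tri f i j k \<Longrightarrow> tri f j k i"
  by (auto simp: tri_def)

lemma par_rotate: "par f i j k l \<Longrightarrow> par f j k l i"
proof -
  assume p: "par f i j k l"
  then have "(k, i) \<notin> edges T n v" "v j + v l = v k + v i"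
    using edges_sym[of i k T n v] by (simp_all add: par_def add.commute)
  then show ?thesis
    using p unfolding par_def by (simp add: insert_commute)
qed

lemma face_bdry_sub_verts: "(i, j) \<in> face_bdry T n v f \<Longrightarrow> i \<in> face_verts n v f \<and> j \<in> face_verts n v f"
  by (auto simp: face_bdry_def face_verts_def edges_def segments_def)

lemma face_bdry_edge: "(i, j) \<in> face_bdry T n v f \<Longrightarrow> (i, j) \<in> edges T n v"
  by (auto simp: face_bdry_def)

text \<open>Every ordered pair of distinct vertices is one of the three listed boundary edges or the
  reverse of one, and antisymmetry excludes the reverses.\<close>

lemma ccw_tri:
  assumes f: "f \<in> faces T" and c: "ccw_order T n v f [i, j, k]"
  shows "tri f i j k"
proof -
  note c = c[unfolded ccw_order_def]
  have d: "distinct [i, j, k]"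
    using c by (rule conjunct1)
  have vs: "face_verts n v f = {i, j, k}"
    using c[THEN conjunct2, THEN conjunct1] by simp
  have "length [i, j, k] = 3"
    by simp
  with c[THEN conjunct2, THEN conjunct2]
  have "\<forall>a<3. ([i, j, k] ! a, [i, j, k] ! (Suc a mod 3)) \<in> face_bdry T n v f"
    by metis
  from this[rule_format, of 0] this[rule_format, of 1] this[rule_format, of 2]
  have b: "(i, j) \<in> face_bdry T n v f" "(j, k) \<in> face_bdry T n v f" "(k, i) \<in> face_bdry T n v f"
    by auto
  have "e \<in> {(i, j), (j, k), (k, i)}" if e: "e \<in> face_bdry T n v f" for e
  proof -
    obtain x y where xy: "e = (x, y)" by fastforce
    have "x \<in> {i,j,k}" "y \<in> {i,j,k}"
      using face_bdry_sub_verts[of x y f] e vs xy by simp_all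
    moreover have "x \<noteq> y"
      using edgeD(3)[of x y] face_bdry_edge[of x y f] e xy by simp
    moreover have "(y, x) \<notin> face_bdry T n v f"
      using face_bdry_antisym[OF f] e xy by simp
    ultimately show ?thesis
      using b xy by auto
  qed
  then have "face_bdry T n v f \<subseteq> {(i, j), (j, k), (k, i)}"
    by (rule subsetI)
  then show ?thesis
    using d vs b unfolding tri_def by blast
qed

text \<open>The two diagonals share their midpoint. If one of them were a face, it would have to
  contain the ends of the other, but a vertex of T on a segment of T is one of its ends.\<close>

lemma diagonal_not_edge:
  assumes ids: "i \<in> {1..n}" "j \<in> {1..n}" "k \<in> {1..n}" "l \<in> {1..n}" and d: "distinct [i, j, k, l]"
    and par: "v i + v k = v j + v l"
  shows "(i, k) \<notin> edges T n v"
proof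
  assume e: "(i, k) \<in> edges T n v"
  have "midpoint (v j) (v l) = midpoint (v i) (v k)"
    using par by (simp add: midpoint_def)
  then have "midpoint (v j) (v l) \<in> closed_segment (v i) (v k)"
    by simp
  moreover have "midpoint (v j) (v l) \<in> open_segment (v j) (v l)"
    using ids d v_eq_iff by (simp add: midpoint_in_open_segment)
  ultimately have "v j \<in> closed_segment (v i) (v k)"
    using face_ofD[OF edgeD(4)[OF e]] vertex_in ids by blast
  then have "v j = v i \<or> v j = v k"
    using vertex_in_segment[of j "v i" "v k"] vertex_in ids by blast
  then show False
    using ids d v_eq_iff[of j i] v_eq_iff[of j k] by auto
qed

lemma ccw_par:
  assumes f: "f \<in> faces T" and c: "ccw_order T n v f [i, j, k, l]" and t: "tau v i j = tau v l k"
  shows "par f i j k l"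
proof -
  note c = c[unfolded ccw_order_def]
  have d: "distinct [i, j, k, l]"
    using c by (rule conjunct1)
  have vs: "face_verts n v f = {i, j, k, l}"
    using c[THEN conjunct2, THEN conjunct1] by simp
  have "length [i, j, k, l] = 4"
    by simp
  with c[THEN conjunct2, THEN conjunct2]
  have "\<forall>a<4. ([i, j, k, l] ! a, [i, j, k, l] ! (Suc a mod 4)) \<in> face_bdry T n v f"
    by metis
  from this[rule_format, of 0] this[rule_format, of 1] this[rule_format, of 2] this[rule_format, of 3]
  have b: "(i, j) \<in> face_bdry T n v f" "(j, k) \<in> face_bdry T n v f"
      "(k, l) \<in> face_bdry T n v f" "(l, i) \<in> face_bdry T n v f"
    by simp_all
  have eq: "v i + v k = v j + v l"
    using t by (simp add: tau_def algebra_simps)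
  have "face_verts n v f \<subseteq> {1..n}"
    by (auto simp: face_verts_def)
  then have ids: "i \<in> {1..n}" "j \<in> {1..n}" "k \<in> {1..n}" "l \<in> {1..n}"
    unfolding vs by auto
  have nd: "(i, k) \<notin> edges T n v" "(j, l) \<notin> edges T n v"
    using diagonal_not_edge[of i j k l] diagonal_not_edge[of j i l k] ids d eq by auto
  then have nd': "(k, i) \<notin> edges T n v" "(l, j) \<notin> edges T n v"
    using edges_sym[of i k T n v] edges_sym[of j l T n v] by simp_all
  have "e \<in> {(i, j), (j, k), (k, l), (l, i)}" if e: "e \<in> face_bdry T n v f" for e
  proof -
    obtain x y where xy: "e = (x, y)" by fastforce
    have "x \<in> {i,j,k,l}" "y \<in> {i,j,k,l}"
      using face_bdry_sub_verts[of x y f] e vs xy by simp_all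
    moreover have "(x, y) \<in> edges T n v"
      using face_bdry_edge[of x y f] e xy by simp
    moreover from this have "x \<noteq> y"
      by (rule edgeD(3))
    moreover have "(y, x) \<notin> face_bdry T n v f"
      using face_bdry_antisym[OF f] e xy by simp
    ultimately show ?thesis
      using b nd nd' xy by auto
  qed
  then have "face_bdry T n v f \<subseteq> {(i, j), (j, k), (k, l), (l, i)}"
    by (rule subsetI)
  then show ?thesis
    using d vs b eq nd unfolding par_def by blast
qed

lemma face_tri_or_par:
  assumes f: "f \<in> faces T"
  shows "(\<exists>i j k. tri f i j k) \<or> (\<exists>i j k l. par f i j k l)"
  using face_shape[OF f]
proof (elim disjE exE conjE)
  fix i j k assume "ccw_order T n v f [i, j, k]"
  from ccw_tri[OF f this] show ?thesis by blast
next
  fix i j k l assume "ccw_order T n v f [i, j, k, l]" "tau v i j = tau v l k"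
  from ccw_par[OF f this] show ?thesis by blast
qed

lemma face_cases:
  assumes f: "f \<in> faces T" and i: "i \<in> face_verts n v f"
  obtains (tri) j k where "tri f i j k" | (par) j k l where "par f i j k l"
proof -
  have "(\<exists>j k. tri f i j k) \<or> (\<exists>j k l. par f i j k l)"
    using face_tri_or_par[OF f]
  proof (elim disjE exE)
    fix a b c assume t: "tri f a b c"
    then have "i = a \<or> i = b \<or> i = c"
      using i unfolding tri_def by simp
    then show ?thesis
      using t tri_rotate[OF t] tri_rotate[OF tri_rotate[OF t]] by (elim disjE) blast+
  next
    fix a b c d assume p: "par f a b c d"
    then have "i = a \<or> i = b \<or> i = c \<or> i = d"
      using i unfolding par_def by simp
    then show ?thesis
      using p par_rotate[OF p] par_rotate[OF par_rotate[OF p]]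
        par_rotate[OF par_rotate[OF par_rotate[OF p]]] by (elim disjE) blast+
  qed
  then show thesis
    using that by blast
qed

section \<open>Supporting planes at an edge\<close>

lemma facet_other_edge:
  assumes f: "f \<in> faces T" "i \<in> face_verts n v f"
  obtains m where "m \<noteq> j" "(i, m) \<in> edges T n v" "m \<in> face_verts n v f"
  using f
proof (cases rule: face_cases)
  case (tri a b)
  then have "(i, a) \<in> face_bdry T n v f" "(b, i) \<in> face_bdry T n v f"
    "a \<in> face_verts n v f" "b \<in> face_verts n v f" "a \<noteq> b"
    by (simp_all add: tri_def)
  then show ?thesis
    using that[of a] that[of b] face_bdry_edge edges_sym by blast
next
  case (par a c b)
  then have "(i, a) \<in> face_bdry T n v f" "(b, i) \<in> face_bdry T n v f"
    "a \<in> face_verts n v f" "b \<in> face_verts n v f" "a \<noteq> b"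
    by (simp_all add: par_def)
  then show ?thesis
    using that[of a] that[of b] face_bdry_edge edges_sym by blast
qed

lemma third_vertex_not_in_other_facet:
  assumes f: "f \<in> faces T" "g \<in> faces T" "f \<noteq> g"
    and ij: "i \<in> face_verts n v f \<inter> face_verts n v g" "j \<in> face_verts n v f \<inter> face_verts n v g" "i \<noteq> j"
    and m: "m \<in> face_verts n v f" "m \<noteq> i" "m \<noteq> j"
  shows "m \<notin> face_verts n v g"
proof
  assume mg: "m \<in> face_verts n v g"
  have ids: "i \<in> {1..n}" "j \<in> {1..n}" "m \<in> {1..n}"
    using ij m unfolding face_verts_def by blast+
  have "v i \<in> f \<inter> g" "v j \<in> f \<inter> g" "v m \<in> f \<inter> g"
    using ij m mg unfolding face_verts_def by blast+
  then have "v m \<in> closed_segment (v i) (v j)"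
    using facets_meet_in_edge(2)[OF f ids(1,2) ij(3)] by blast
  then have "v m = v i \<or> v m = v j"
    using vertex_in_segment[OF ids(3)] vertex_in ids by blast
  then show False
    using m v_eq_iff ids by blast
qed

text \<open>At an edge, T lies in the wedge between the planes of the two facets. Modulo the edge
  direction this wedge is generated by one more edge vector from \<open>v i\<close> in each facet,
  so it suffices to test w on these two.\<close>

lemma edge_supporting_plane:
  assumes e: "(i, j) \<in> edges T n v" and w0: "w \<bullet> tau v i j = 0"
    and w: "\<And>f m. f \<in> faces T \<Longrightarrow> {i, j, m} \<subseteq> face_verts n v f \<Longrightarrow> (i, m) \<in> edges T n v \<Longrightarrow> 0 \<le> w \<bullet> tau v i m"
    and x: "x \<in> T"
  shows "0 \<le> w \<bullet> (x - v i)"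
proof -
  obtain f g where fg: "f \<in> faces T" "g \<in> faces T" "f \<noteq> g" "v i \<in> f" "v j \<in> f" "v i \<in> g" "v j \<in> g"
    using edge_two_facets[OF e] by blast
  note ids = edgeD(1,2,3)[OF e]
  have verts: "i \<in> face_verts n v f" "j \<in> face_verts n v f" "i \<in> face_verts n v g" "j \<in> face_verts n v g"
    using fg ids by (simp_all add: face_verts_def)
  obtain a where a: "a \<noteq> j" "(i, a) \<in> edges T n v" "a \<in> face_verts n v f"
    using facet_other_edge[OF fg(1) verts(1)] .
  obtain b where b: "b \<noteq> j" "(i, b) \<in> edges T n v" "b \<in> face_verts n v g"
    using facet_other_edge[OF fg(2) verts(3)] .
  have ag: "a \<notin> face_verts n v g"
    using third_vertex_not_in_other_facet[OF fg(1-3), of i j a] verts ids a edgeD(3)[OF a(2)] by blast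
  have bf: "b \<notin> face_verts n v f"
    using third_vertex_not_in_other_facet[OF fg(2,1) fg(3)[symmetric], of i j b] verts ids b edgeD(3)[OF b(2)] by blast
  define p where "p = outward_normal T f"
  define q where "q = outward_normal T g"
  have va: "v a \<in> T" "v a \<in> f" "v a \<notin> g" and vb: "v b \<in> T" "v b \<in> g" "v b \<notin> f" and vj: "v j \<in> T"
    using a b ag bf vertex_in ids by (simp_all add: face_verts_def)
  have pj: "p \<bullet> tau v i j = 0" and pa: "p \<bullet> tau v i a = 0" and qj: "q \<bullet> tau v i j = 0" and qb: "q \<bullet> tau v i b = 0"
    using outward_normal_props(3)[OF fg(1) vj fg(4)] outward_normal_props(3)[OF fg(1) va(1) fg(4)]
      outward_normal_props(3)[OF fg(2) vj fg(6)] outward_normal_props(3)[OF fg(2) vb(1) fg(6)] fg va vb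
    by (simp_all add: p_def q_def tau_def)
  have pb: "p \<bullet> tau v i b < 0" and qa: "q \<bullet> tau v i a < 0"
    using outward_normal_props(2,3)[OF fg(1) vb(1) fg(4)] outward_normal_props(2,3)[OF fg(2) va(1) fg(6)] va vb
    by (simp_all add: p_def q_def tau_def less_le)
  have px: "p \<bullet> (x - v i) \<le> 0" and qx: "q \<bullet> (x - v i) \<le> 0"
    using outward_normal_props(2)[OF fg(1) x fg(4)] outward_normal_props(2)[OF fg(2) x fg(6)]
    by (simp_all add: p_def q_def)
  \<comment> \<open>The normal q vanishes on the edge and on \<open>tau v i b\<close>, so it reads
    off the coefficient of \<open>tau v i a\<close>; p does the same for the other coefficient.
    Numerators and denominators are nonpositive because the normals point outward.\<close>
  define \<beta> where "\<beta> = q \<bullet> (x - v i) / (q \<bullet> tau v i a)"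
  define \<gamma> where "\<gamma> = p \<bullet> (x - v i) / (p \<bullet> tau v i b)"
  have pos: "0 \<le> \<beta>" "0 \<le> \<gamma>"
    using px qx pb qa by (simp_all add: \<beta>_def \<gamma>_def divide_nonpos_neg)
  define r where "r = x - v i - \<beta> *\<^sub>R tau v i a - \<gamma> *\<^sub>R tau v i b"
  have pr: "p \<bullet> r = 0"
    using pa pb by (simp add: r_def \<gamma>_def inner_diff_right[of p _ "_ *\<^sub>R _"])
  have qr: "q \<bullet> r = 0"
    using qb qa by (simp add: r_def \<beta>_def inner_diff_right[of q _ "_ *\<^sub>R _"])
  let ?t = "tau v i j"
  have t: "?t \<noteq> 0"
    using ids v_eq_iff by (simp add: tau_def)
  \<comment> \<open>What remains is orthogonal to both normals, as the edge is. Since the normals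
    are independent, it is a multiple of the edge vector, on which w vanishes.\<close>
  have "cross3 p q \<noteq> 0"
  proof
    assume "cross3 p q = 0"
    moreover have "p \<noteq> 0"
      using pb by auto
    ultimately have q: "q = (p \<bullet> q / (p \<bullet> p)) *\<^sub>R p"
      by (rule cross3_eq_0_imp_multiple)
    have "q \<bullet> tau v i a = (p \<bullet> q / (p \<bullet> p)) * (p \<bullet> tau v i a)"
      by (subst q) simp
    then show False
      using pa qa by simp
  qed
  moreover have "cross3 (cross3 p q) r = 0" "cross3 (cross3 p q) ?t = 0"
    using pr qr pj qj by (simp_all add: cross_skew[of "cross3 p q"] Lagrange inner_commute)
  ultimately obtain c d where cd: "r = c *\<^sub>R cross3 p q" "?t = d *\<^sub>R cross3 p q"
    using cross3_eq_0_imp_multiple by metis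
  then have "d \<noteq> 0" "w \<bullet> cross3 p q = 0"
    using t w0 by auto
  then have "w \<bullet> r = 0"
    using cd by simp
  moreover have "x - v i = r + \<beta> *\<^sub>R tau v i a + \<gamma> *\<^sub>R tau v i b"
    by (simp add: r_def)
  ultimately have "w \<bullet> (x - v i) = \<beta> * (w \<bullet> tau v i a) + \<gamma> * (w \<bullet> tau v i b)"
    by (simp add: inner_add_right)
  moreover have "0 \<le> w \<bullet> tau v i a" "0 \<le> w \<bullet> tau v i b"
    using w[OF fg(1) _ a(2)] w[OF fg(2) _ b(2)] verts a b by auto
  ultimately show ?thesis
    using pos by simp
qed

text \<open>Every face of a polyhedron is exposed, in particular each vertex. A functional that is
  positive on all directions leaving \<open>v i\<close> defines the plane that cuts out the vertex
  figure.\<close>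

lemma exposing_functional:
  assumes i: "i \<in> {1..n}"
  obtains p where "\<And>k. k \<in> {1..n} \<Longrightarrow> k \<noteq> i \<Longrightarrow> 0 < p \<bullet> tau v i k"
proof -
  have "{v i} face_of T"
    using vertex_extreme[OF i] by (simp add: face_of_singleton)
  then have "{v i} exposed_face_of T"
    using exposed_face_of_polyhedron[OF polyhedron] by blast
  then obtain a b where ab: "T \<subseteq> {x. a \<bullet> x \<le> b}" "{v i} = T \<inter> {x. a \<bullet> x = b}"
    unfolding exposed_face_of_def by blast
  have "0 < (- a) \<bullet> tau v i k" if k: "k \<in> {1..n}" "k \<noteq> i" for k
  proof -
    have vi: "a \<bullet> v i = b" and "a \<bullet> v k \<le> b" and "v k \<noteq> v i"
      using ab vertex_in[OF k(1)] v_eq_iff[OF k(1) i] k by blast+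
    then have "a \<bullet> v k \<noteq> b"
      using ab(2) vertex_in[OF k(1)] by blast
    then show ?thesis
      using vi \<open>a \<bullet> v k \<le> b\<close> by (simp add: tau_def inner_diff_right)
  qed
  then show ?thesis
    using that by blast
qed

text \<open>Equality would put two vertices on one ray from \<open>v i\<close>, the nearer one
  inside the segment to the farther one, against extremality.\<close>

lemma negative_multiples_distinct:
  assumes ids: "i \<in> {1..n}" "j \<in> {1..n}" "k \<in> {1..n}" "i \<noteq> j" "i \<noteq> k" "j \<noteq> k" and neg: "s < 0" "t < 0"
  shows "s *\<^sub>R tau v i j - t *\<^sub>R tau v i k \<noteq> 0"
proof
  assume eq: "s *\<^sub>R tau v i j - t *\<^sub>R tau v i k = 0"
  have between: False
    if jk: "j \<in> {1..n}" "k \<in> {1..n}" "i \<noteq> j" "j \<noteq> k" and c: "tau v i j = c *\<^sub>R tau v i k" "0 < c" "c \<le> 1"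
    for j k and c :: real
  proof -
    have "v j = (1 - c) *\<^sub>R v i + c *\<^sub>R v k"
      using c by (simp add: tau_def algebra_simps)
    then have "v j \<in> closed_segment (v i) (v k)"
      using c unfolding closed_segment_def by force
    then have "v j = v i \<or> v j = v k"
      using vertex_in_segment vertex_in ids(1) jk by blast
    then show False
      using v_eq_iff ids(1) jk by blast
  qed
  have "(1 / s) *\<^sub>R (s *\<^sub>R tau v i j) = (1 / s) *\<^sub>R (t *\<^sub>R tau v i k)"
    using eq by simp
  then have j: "tau v i j = (t / s) *\<^sub>R tau v i k"
    using neg by simp
  have "(1 / t) *\<^sub>R (s *\<^sub>R tau v i j) = (1 / t) *\<^sub>R (t *\<^sub>R tau v i k)"
    using eq by simp
  then have k: "tau v i k = (s / t) *\<^sub>R tau v i j"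
    using neg by simp
  have "t / s \<le> 1 \<or> s / t \<le> 1"
    using neg by (simp add: divide_simps) linarith
  then show False
    using between[OF ids(2,3,4,6) j] between[OF ids(3,2,5) _ k] ids neg by (auto simp: zero_less_divide_iff)
qed

section \<open>Closed cochains on the boundary are exact\<close>

text \<open>Dividing \<open>l \<bullet> tau v i k\<close> by \<open>p \<bullet> tau v i k\<close>
  gives the height of the direction to \<open>v k\<close> within the vertex figure cut by p. On a
  convex polygon a local minimum of a linear function is a global one, so from each descending edge
  one reaches the lowest edge through adjacent facets without leaving the descending ones.\<close>

lemma lower_link_connected:
  fixes val :: "nat \<Rightarrow> real" and l :: "real^3"
  assumes i: "i \<in> {1..n}"
    and adj: "\<And>f j k. f \<in> faces T \<Longrightarrow> {i, j, k} \<subseteq> face_verts n v f \<Longrightarrow>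
       (i, j) \<in> edges T n v \<Longrightarrow> (i, k) \<in> edges T n v \<Longrightarrow> j \<noteq> k \<Longrightarrow>
       l \<bullet> tau v i j < 0 \<Longrightarrow> l \<bullet> tau v i k < 0 \<Longrightarrow> val j = val k"
    and a: "(i, a) \<in> edges T n v" "l \<bullet> tau v i a < 0"
    and b: "(i, b) \<in> edges T n v" "l \<bullet> tau v i b < 0"
  shows "val a = val b"
proof -
  define D where "D = {j. (i, j) \<in> edges T n v \<and> l \<bullet> tau v i j < 0}"
  have D_sub: "D \<subseteq> {1..n} - {i}"
    using edgeD unfolding D_def by blast
  then have fin: "finite D"
    using finite_subset by blast
  define U where "U = (\<Inter>k\<in>{1..n} - {i}. {p. tau v i k \<bullet> p > 0})"
  \<comment> \<open>If p is orthogonal to such a vector, then j and k have the same height in the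
    vertex figure. Avoiding N makes \<open>g\<close> injective on D.\<close>
  define N where "N = (\<lambda>(j, k). (l \<bullet> tau v i k) *\<^sub>R tau v i j - (l \<bullet> tau v i j) *\<^sub>R tau v i k) ` {(j, k) \<in> D \<times> D. j \<noteq> k}"
  have "open U"
    unfolding U_def by (intro open_INT) (auto intro: open_halfspace_gt)
  moreover have "U \<noteq> {}"
  proof -
    obtain p where "\<And>k. k \<in> {1..n} \<Longrightarrow> k \<noteq> i \<Longrightarrow> 0 < p \<bullet> tau v i k"
      using exposing_functional[OF i] by blast
    then have "p \<in> U"
      unfolding U_def by (simp add: inner_commute)
    then show ?thesis by blast
  qed
  moreover have "finite N"
    unfolding N_def by (rule finite_imageI, rule finite_subset[of _ "D \<times> D"]) (use fin in auto)
  moreover have "0 \<notin> N"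
  proof
    assume "0 \<in> N"
    then obtain j k where jk: "j \<in> D" "k \<in> D" "j \<noteq> k"
      "(l \<bullet> tau v i k) *\<^sub>R tau v i j - (l \<bullet> tau v i j) *\<^sub>R tau v i k = 0"
      unfolding N_def by auto
    moreover have "j \<in> {1..n}" "k \<in> {1..n}" "i \<noteq> j" "i \<noteq> k" "l \<bullet> tau v i k < 0" "l \<bullet> tau v i j < 0"
      using jk D_sub unfolding D_def by blast+
    ultimately show False
      using negative_multiples_distinct[OF i] by blast
  qed
  ultimately obtain p where p: "p \<in> U" "\<And>u. u \<in> N \<Longrightarrow> p \<bullet> u \<noteq> 0"
    using generic_vector_in_open by blast
  have ppos: "0 < p \<bullet> tau v i k" if "k \<in> {1..n}" "k \<noteq> i" for k
    using p(1) that unfolding U_def by (simp add: inner_commute)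
  define g where "g k = (l \<bullet> tau v i k) / (p \<bullet> tau v i k)" for k
  have g_inj: "j = k" if "j \<in> D" "k \<in> D" "g j = g k" for j k
  proof (rule ccontr)
    assume "j \<noteq> k"
    then have "(l \<bullet> tau v i k) *\<^sub>R tau v i j - (l \<bullet> tau v i j) *\<^sub>R tau v i k \<in> N"
      using that unfolding N_def by force
    then have "(l \<bullet> tau v i k) * (p \<bullet> tau v i j) - (l \<bullet> tau v i j) * (p \<bullet> tau v i k) \<noteq> 0"
      using p(2) by (fastforce simp: inner_diff_right)
    moreover have "0 < p \<bullet> tau v i j" "0 < p \<bullet> tau v i k"
      using ppos that D_sub by blast+
    ultimately show False
      using that(3) by (simp add: g_def field_simps)
  qed
  have all_eq: "\<exists>c. \<forall>j\<in>D. val j = c" 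
  proof (rule ccontr)
    assume neg: "\<not> ?thesis"
    then have "D \<noteq> {}"
      by blast
    then obtain j0 where j0: "j0 \<in> D" "\<And>k. k \<in> D \<Longrightarrow> g j0 \<le> g k"
      using ex_min_if_finite[of "g ` D"] fin by (auto simp: not_less)
    define B where "B = {j \<in> D. val j \<noteq> val j0}"
    have "B \<noteq> {}" "finite B"
      using neg fin unfolding B_def by auto
    \<comment> \<open>A descending edge lower than j in a common facet would carry the same value by
      \<open>adj\<close> and hence belong to B. So j is a local minimum although j0 lies
      lower.\<close>
    then obtain j where j: "j \<in> B" "\<And>k. k \<in> B \<Longrightarrow> g j \<le> g k"
      using ex_min_if_finite[of "g ` B"] by (auto simp: not_less)
    have jD: "j \<in> D" and ej: "(i, j) \<in> edges T n v" and lj: "l \<bullet> tau v i j < 0"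
      using j(1) unfolding B_def D_def by blast+
    have pj: "0 < p \<bullet> tau v i j"
      using ppos jD D_sub by blast
    \<comment> \<open>The functional w compares heights with that of j: for a vertex k other than i,
      \<open>w \<bullet> tau v i k\<close> is nonnegative exactly when g k is at least g j. Local
      minimality makes it a supporting functional along the edge, hence nonnegative at j0
      too.\<close>
    define w where "w = l - g j *\<^sub>R p"
    have w_dot: "w \<bullet> tau v i k = l \<bullet> tau v i k - g j * (p \<bullet> tau v i k)" for k
      by (simp add: w_def inner_diff_left)
    have w0: "w \<bullet> tau v i j = 0"
      using pj by (simp add: w_dot g_def)
    have gj: "g j < 0"
      using pj lj by (simp add: g_def divide_neg_pos)
    have "0 \<le> w \<bullet> tau v i m"
      if f: "f \<in> faces T" "{i, j, m} \<subseteq> face_verts n v f" and m: "(i, m) \<in> edges T n v" for f m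
    proof (rule ccontr)
      assume "\<not> ?thesis"
      then have less: "l \<bullet> tau v i m < g j * (p \<bullet> tau v i m)"
        by (simp add: w_dot)
      have pm: "0 < p \<bullet> tau v i m"
        using ppos edgeD[OF m] by blast
      have "l \<bullet> tau v i m < 0"
        using less mult_neg_pos[OF gj pm] by linarith
      then have mD: "m \<in> D" and lm: "l \<bullet> tau v i m < 0"
        using m unfolding D_def by blast+
      have gm: "g m < g j"
        using less pm by (simp add: g_def divide_less_eq)
      have "j \<noteq> m"
        using gm by blast
      then have "val j = val m"
        using adj[OF f ej m _ lj lm] by blast
      then have "m \<in> B"
        using j(1) mD unfolding B_def by simp
      then show False
        using j(2) gm by fastforce
    qed
    moreover have j0n: "j0 \<in> {1..n}" "j0 \<noteq> i"
      using j0(1) D_sub by blast+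
    ultimately have "0 \<le> w \<bullet> (v j0 - v i)"
      using edge_supporting_plane[OF ej w0] vertex_in by blast
    then have "g j \<le> g j0"
      using w_dot[of j0] ppos[OF j0n] by (simp add: g_def tau_def le_divide_eq)
    then have "g j = g j0"
      using j0(2)[OF jD] by simp
    then have "j = j0"
      using g_inj jD j0(1) by blast
    then show False
      using j(1) unfolding B_def by simp
  qed
  moreover have "a \<in> D" "b \<in> D"
    using a b unfolding D_def by blast+
  ultimately show ?thesis
    by metis
qed

lemma generic_height:
  obtains l where "\<And>i j. i \<in> {1..n} \<Longrightarrow> j \<in> {1..n} \<Longrightarrow> i \<noteq> j \<Longrightarrow> l \<bullet> v i \<noteq> l \<bullet> v j"
proof -
  let ?N = "(\<lambda>(i, j). v i - v j) ` segments n"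
  have "0 \<notin> ?N"
    using v_eq_iff by (auto simp: segments_def)
  moreover have "finite ?N"
    using finite_segments by blast
  ultimately obtain l where l: "\<And>u. u \<in> ?N \<Longrightarrow> l \<bullet> u \<noteq> 0"
    using generic_vector_in_open[of UNIV] by auto
  show ?thesis
  proof
    fix i j assume "i \<in> {1..n}" "j \<in> {1..n}" "i \<noteq> j"
    then have "v i - v j \<in> ?N"
      by (auto simp: segments_def)
    then have "l \<bullet> (v i - v j) \<noteq> 0"
      by (rule l)
    then show "l \<bullet> v i \<noteq> l \<bullet> v j"
      by (simp add: inner_diff_right)
  qed
qed

text \<open>The first cohomology of the boundary vanishes: a potential is built by sweeping upwards
  through the vertices along a generic height function. Its value at the next vertex can be read
  off along any descending edge, because the descending edges are linked through facets whose
  other vertices are lower.\<close>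

lemma closed_cochain_exact:
  fixes z :: "nat \<Rightarrow> nat \<Rightarrow> real"
  assumes anti: "\<And>i j. z j i = - z i j"
    and closed: "\<And>f. f \<in> faces T \<Longrightarrow> (\<Sum>(i, j)\<in>face_bdry T n v f. z i j) = 0"
  obtains p where "\<And>i j. (i, j) \<in> edges T n v \<Longrightarrow> z i j = p j - p i"
proof -
  obtain l where l: "\<And>i j. i \<in> {1..n} \<Longrightarrow> j \<in> {1..n} \<Longrightarrow> i \<noteq> j \<Longrightarrow> l \<bullet> v i \<noteq> l \<bullet> v j"
    using generic_height by blast
  have ltau: "l \<bullet> tau v i j < 0 \<longleftrightarrow> l \<bullet> v j < l \<bullet> v i" for i j
    by (simp add: tau_def inner_diff_right)
  \<comment> \<open>The induction runs over vertex sets closed under descent; the potential is asked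
    for only on edges inside the set.\<close>
  have "\<exists>p. \<forall>(i, j)\<in>edges T n v \<inter> S \<times> S. z i j = p j - p i"
    if "S \<subseteq> {1..n}" "\<And>i j. i \<in> S \<Longrightarrow> j \<in> {1..n} \<Longrightarrow> l \<bullet> v j < l \<bullet> v i \<Longrightarrow> j \<in> S" for S
    using that
  proof (induction "card S" arbitrary: S)
    case 0
    then have "S = {}"
      using finite_subset[OF 0(2)] by simp
    then show ?case by simp
  next
    case (Suc m)
    have fin: "finite S" and "S \<noteq> {}"
      using finite_subset[OF Suc.prems(1)] Suc.hyps(2) by auto
    then obtain i where i: "i \<in> S" "\<And>j. j \<in> S \<Longrightarrow> l \<bullet> v j \<le> l \<bullet> v i"
      using ex_min_if_finite[of "(\<lambda>j. - (l \<bullet> v j)) ` S"] by (auto simp: not_less)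
    have iV: "i \<in> {1..n}"
      using i(1) Suc.prems(1) by blast
    define S' where "S' = S - {i}"
    have lower: "j \<in> S' \<longleftrightarrow> j \<in> {1..n} \<and> l \<bullet> v j < l \<bullet> v i" for j
    proof
      assume "j \<in> S'"
      then have "j \<in> S" "j \<noteq> i"
        unfolding S'_def by blast+
      moreover from this have "j \<in> {1..n}"
        using Suc.prems(1) by blast
      ultimately show "j \<in> {1..n} \<and> l \<bullet> v j < l \<bullet> v i"
        using i(2)[of j] l[of j i] iV by auto
    next
      assume "j \<in> {1..n} \<and> l \<bullet> v j < l \<bullet> v i"
      then show "j \<in> S'"
        using Suc.prems(2)[OF i(1)] unfolding S'_def by blast
    qed
    have "m = card S'" "S' \<subseteq> {1..n}"
      using Suc.hyps(2) Suc.prems(1) i(1) fin unfolding S'_def by auto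
    moreover have "k \<in> S'" if "j \<in> S'" "k \<in> {1..n}" "l \<bullet> v k < l \<bullet> v j" for j k
      using that lower by force
    ultimately obtain p where p: "\<forall>(i, j)\<in>edges T n v \<inter> S' \<times> S'. z i j = p j - p i"
      using Suc.hyps(1)[of S'] by blast
    have p: "z j k = p k - p j" if "(j, k) \<in> edges T n v" "j \<in> S'" "k \<in> S'" for j k
      using p that by blast
    \<comment> \<open>The value that the edge from j forces on the potential at the new top vertex
      i.\<close>
    define val where "val j = p j + z j i" for j
    have adj: "val j = val k"
      if f: "f \<in> faces T" "{i, j, k} \<subseteq> face_verts n v f"
        and e: "(i, j) \<in> edges T n v" "(i, k) \<in> edges T n v" "j \<noteq> k"
        and lt: "l \<bullet> tau v i j < 0" "l \<bullet> tau v i k < 0" for f j k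
    proof -
      have jk: "j \<in> S'" "k \<in> S'"
        using lower edgeD e lt ltau by blast+
      have ne: "i \<noteq> j" "i \<noteq> k"
        using edgeD(3)[OF e(1)] edgeD(3)[OF e(2)] by simp_all
      have "i \<in> face_verts n v f"
        using f(2) by blast
      with f(1) show ?thesis
      proof (cases rule: face_cases)
        case (tri a b)
        then have ab: "{j, k} = {a, b}" and d: "distinct [i, a, b]"
          and bd: "face_bdry T n v f = {(i, a), (a, b), (b, i)}"
          using f(2) ne e(3) unfolding tri_def by auto
        have S': "a \<in> S'" "b \<in> S'"
          using ab jk by (auto simp: doubleton_eq_iff)
        have "z i a + z a b + z b i = 0"
          using closed[OF f(1)] d unfolding bd by simp
        moreover have "z a b = p b - p a"
          using p[OF _ S'] face_bdry_edge[of a b f] bd by blast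
        ultimately have "val a = val b"
          using anti[of a i] unfolding val_def by simp
        then show ?thesis
          using ab by (auto simp: doubleton_eq_iff)
      next
        case (par a c b)
        then have d: "distinct [i, a, c, b]" and bd: "face_bdry T n v f = {(i, a), (a, c), (c, b), (b, i)}"
          and sum: "v i + v c = v a + v b" and "(i, c) \<notin> edges T n v" and vs: "face_verts n v f = {i, a, c, b}"
          unfolding par_def by simp_all
        then have "j \<noteq> c" "k \<noteq> c"
          using e by blast+
        then have ab: "{j, k} = {a, b}"
          using f(2) ne e(3) vs by auto
        have S': "a \<in> S'" "b \<in> S'"
          using ab jk by (auto simp: doubleton_eq_iff)
        \<comment> \<open>Opposite corners have equal height sums. Both neighbours of i lie below i,
          so the far corner lies below them and already has a potential.\<close>
        have "l \<bullet> v i + l \<bullet> v c = l \<bullet> v a + l \<bullet> v b"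
          using sum by (metis inner_add_right)
        moreover have "l \<bullet> v a < l \<bullet> v i" "l \<bullet> v b < l \<bullet> v i"
          using S' lower by blast+
        moreover have "c \<in> {1..n}"
          using vs unfolding face_verts_def by blast
        ultimately have c: "c \<in> S'"
          using lower by simp
        have "z i a + z a c + z c b + z b i = 0"
          using closed[OF f(1)] d unfolding bd by simp
        moreover have "z a c = p c - p a" "z c b = p b - p c"
          using p[OF _ S'(1) c] p[OF _ c S'(2)] face_bdry_edge[of _ _ f] bd by blast+
        ultimately have "val a = val b"
          using anti[of a i] unfolding val_def by simp
        then show ?thesis
          using ab by (auto simp: doubleton_eq_iff)
      qed
    qed
    have const: "val j = val k" if "(i, j) \<in> edges T n v" "(i, k) \<in> edges T n v" "j \<in> S'" "k \<in> S'" for j k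
    proof -
      have "l \<bullet> tau v i j < 0" "l \<bullet> tau v i k < 0"
        using that(3,4) lower ltau by simp_all
      with adj show ?thesis
        using lower_link_connected[of i l val j k, OF iV _ that(1) _ that(2)] by blast
    qed
    have "\<exists>c. \<forall>j. (i, j) \<in> edges T n v \<longrightarrow> j \<in> S' \<longrightarrow> val j = c"
      using const by metis
    then obtain c where c: "\<And>j. (i, j) \<in> edges T n v \<Longrightarrow> j \<in> S' \<Longrightarrow> val j = c"
      by blast
    define q where "q j = (if j = i then c else p j)" for j
    have "z j k = q k - q j" if e: "(j, k) \<in> edges T n v" and S: "j \<in> S" "k \<in> S" for j k
    proof -
      consider "j = i" "k \<in> S'" | "k = i" "j \<in> S'" | "j \<in> S'" "k \<in> S'"
        using S edgeD(3)[OF e] unfolding S'_def by blast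
      then show ?thesis
      proof cases
        case 1
        then have "val k = c" "k \<noteq> i"
          using c e unfolding S'_def by blast+
        then show ?thesis
          using 1 anti[of k i] unfolding q_def val_def by simp
      next
        case 2
        then have "val j = c" "j \<noteq> i"
          using c e edges_sym[of j i T n v] unfolding S'_def by blast+
        then show ?thesis
          using 2 unfolding q_def val_def by simp
      next
        case 3
        then have "j \<noteq> i" "k \<noteq> i"
          unfolding S'_def by blast+
        then show ?thesis
          using 3 p e unfolding q_def by simp
      qed
    qed
    then show ?case by blast
  qed
  from this[of "{1..n}"] obtain p where "\<forall>(i, j)\<in>edges T n v \<inter> {1..n} \<times> {1..n}. z i j = p j - p i"
    by blast
  then show ?thesis
    using that edgeD(1,2) by blast
qed

end

section \<open>Combining antisymmetric arrays along the edges\<close>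

text \<open>Gram-Schmidt for vectors that may be dependent. The induction hypothesis is used for c
  and for the new vector \<open>b h\<close>; the residue of the latter is the direction along which
  the residue of c is projected.\<close>

lemma orthogonal_decomposition:
  fixes c :: "'e \<Rightarrow> real" and b :: "'f \<Rightarrow> 'e \<Rightarrow> real"
  assumes "finite F" "finite E"
  shows "\<exists>y. \<forall>g\<in>F. (\<Sum>e\<in>E. (c e - (\<Sum>f\<in>F. y f * b f e)) * b g e) = 0"
  using assms(1)
proof (induction F arbitrary: c rule: finite_induct)
  case empty
  then show ?case by simp
next
  case (insert h F)
  obtain y1 where y1: "\<And>g. g \<in> F \<Longrightarrow> (\<Sum>e\<in>E. (c e - (\<Sum>f\<in>F. y1 f * b f e)) * b g e) = 0"
    using insert.IH by blast
  obtain y2 where y2: "\<And>g. g \<in> F \<Longrightarrow> (\<Sum>e\<in>E. (b h e - (\<Sum>f\<in>F. y2 f * b f e)) * b g e) = 0"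
    using insert.IH by blast
  define r where "r e = c e - (\<Sum>f\<in>F. y1 f * b f e)" for e
  define q where "q e = b h e - (\<Sum>f\<in>F. y2 f * b f e)" for e
  \<comment> \<open>The projection coefficient. If q vanishes on E, the quotient is 0 by the
    convention for division, and \<open>rq\<close> holds all the same.\<close>
  define t where "t = (\<Sum>e\<in>E. r e * q e) / (\<Sum>e\<in>E. q e * q e)"
  define y where "y f = (if f = h then t else y1 f - t * y2 f)" for f
  have res: "c e - (\<Sum>f\<in>insert h F. y f * b f e) = r e - t * q e" for e
  proof -
    have "(\<Sum>f\<in>F. y f * b f e) = (\<Sum>f\<in>F. (y1 f - t * y2 f) * b f e)"
      by (rule sum.cong) (use insert.hyps in \<open>auto simp: y_def\<close>)
    also have "\<dots> = (\<Sum>f\<in>F. y1 f * b f e) - t * (\<Sum>f\<in>F. y2 f * b f e)"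
      by (simp add: sum_distrib_left sum_subtractf algebra_simps)
    finally show ?thesis
      using insert.hyps by (simp add: y_def r_def q_def algebra_simps)
  qed
  have orth: "(\<Sum>e\<in>E. (r e - t * q e) * b g e) = 0" if "g \<in> F" for g
  proof -
    have "(\<Sum>e\<in>E. (r e - t * q e) * b g e) = (\<Sum>e\<in>E. r e * b g e) - t * (\<Sum>e\<in>E. q e * b g e)"
      by (simp add: sum_distrib_left sum_subtractf algebra_simps)
    then show ?thesis
      using y1[OF that] y2[OF that] by (simp add: r_def q_def)
  qed
  have rq: "(\<Sum>e\<in>E. r e * q e) = t * (\<Sum>e\<in>E. q e * q e)"
  proof (cases "(\<Sum>e\<in>E. q e * q e) = 0")
    case True
    then have "\<forall>e\<in>E. q e = 0"
      using sum_nonneg_eq_0_iff[OF assms(2), of "\<lambda>e. q e * q e"] by auto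
    then show ?thesis by simp
  qed (simp add: t_def)
  have "(\<Sum>e\<in>E. (r e - t * q e) * b h e) =
      (\<Sum>e\<in>E. (r e - t * q e) * q e) + (\<Sum>e\<in>E. \<Sum>f\<in>F. y2 f * ((r e - t * q e) * b f e))"
    unfolding sum.distrib[symmetric]
  proof (rule sum.cong[OF refl])
    fix e
    have "b h e = q e + (\<Sum>f\<in>F. y2 f * b f e)"
      by (simp add: q_def)
    then show "(r e - t * q e) * b h e = (r e - t * q e) * q e + (\<Sum>f\<in>F. y2 f * ((r e - t * q e) * b f e))"
      by (simp add: sum_distrib_left algebra_simps)
  qed
  also have "(\<Sum>e\<in>E. \<Sum>f\<in>F. y2 f * ((r e - t * q e) * b f e)) = (\<Sum>f\<in>F. y2 f * (\<Sum>e\<in>E. (r e - t * q e) * b f e))"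
    by (subst sum.swap) (simp add: sum_distrib_left)
  also have "\<dots> = 0"
    using orth by simp
  also have "(\<Sum>e\<in>E. (r e - t * q e) * q e) + 0 = 0"
    using rq by (simp add: sum_distrib_left sum_subtractf algebra_simps)
  finally have "(\<Sum>e\<in>E. (r e - t * q e) * b g e) = 0" if "g \<in> insert h F" for g
    using orth that by blast
  then show ?case
    unfolding res[symmetric] by blast
qed

text \<open>The combination that turns \<open>W\<^sub>i\<^sub>j\<close> into the form attached to an edge, for an arbitrary array
  in place of the Whitney forms, so that it applies to their curls as well.\<close>

definition combine ::
  "(real^3) set \<Rightarrow> nat \<Rightarrow> (nat \<Rightarrow> real^3) \<Rightarrow> (nat \<Rightarrow> nat \<Rightarrow> nat \<Rightarrow> real) \<Rightarrow>
   (nat \<Rightarrow> nat \<Rightarrow> 'a::real_vector) \<Rightarrow> nat \<Rightarrow> nat \<Rightarrow> 'a" where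
  "combine T n v C W i j =
     W i j
     + (1/2) *\<^sub>R
        ((\<Sum>k | k \<in> edge_nbhd T n v i j \<and> (i, k) \<in> face_diagonals T n v. W i k)
       - (\<Sum>k | k \<in> edge_nbhd T n v i j \<and> (j, k) \<in> face_diagonals T n v. W j k))
     + (1/2) *\<^sub>R
        ((\<Sum>k | (i, k) \<in> inner_diagonals T n v. C i k j *\<^sub>R W i k)
       - (\<Sum>k | (j, k) \<in> inner_diagonals T n v. C j k i *\<^sub>R W j k))"

lemma edge_nbhd_commute: "edge_nbhd T n v i j = edge_nbhd T n v j i"
  by (simp add: edge_nbhd_def closed_segment_commute)

lemma combine_antisym:
  assumes "\<And>i j. W j i = - W i j"
  shows "combine T n v C W j i = - combine T n v C W i j"
  using assms[of i j] by (simp add: combine_def edge_nbhd_commute[of T n v j i] algebra_simps)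

lemma sum_antisym_eq_0:
  fixes g :: "'b \<times> 'b \<Rightarrow> 'a::real_vector"
  assumes "\<And>i j. (i, j) \<in> E \<longleftrightarrow> (j, i) \<in> E" "\<And>i j. g (j, i) = - g (i, j)"
  shows "sum g E = 0"
proof -
  have "sum g E = (\<Sum>e\<in>E. g (prod.swap e))"
    by (rule sum.reindex_bij_witness[of _ prod.swap prod.swap]) (use assms(1) in auto)
  also have "\<dots> = (\<Sum>e\<in>E. - g e)"
    by (rule sum.cong) (use assms(2) in \<open>auto simp: prod.swap_def\<close>)
  also have "\<dots> = - sum g E"
    by (rule sum_negf)
  finally have "2 *\<^sub>R sum g E = 0"
    by (simp add: scaleR_2 eq_neg_iff_add_eq_0)
  then show ?thesis by simp
qed

lemma sum_pairs:
  assumes "finite E" "fst ` E \<subseteq> V" "finite V"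
  shows "sum g E = (\<Sum>i\<in>V. \<Sum>j | (i, j) \<in> E. g (i, j))"
proof -
  have "finite {j. (i, j) \<in> E}" for i
    by (rule finite_subset[of _ "snd ` E"]) (use assms(1) in force)+
  then have "(\<Sum>i\<in>V. \<Sum>j | (i, j) \<in> E. g (i, j)) = (\<Sum>(i, j)\<in>Sigma V (\<lambda>i. {j. (i, j) \<in> E}). g (i, j))"
    using assms(3) by (intro sum.Sigma) auto
  also have "Sigma V (\<lambda>i. {j. (i, j) \<in> E}) = E"
    using assms(2) by force
  finally show ?thesis by simp
qed

context tri_par_polyhedron
begin

lemma finite_faces: "finite (faces T)"
  unfolding faces_def using finite_polytope_facets[OF polytope] .

lemma edges_fst: "fst ` edges T n v \<subseteq> {1..n}"
  using edgeD(1) by fastforce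

lemma finite_pairs_from [simp]:
  "finite {j. (i, j) \<in> edges T n v}" "finite {j. (i, j) \<in> face_diagonals T n v}" "finite {j. (i, j) \<in> inner_diagonals T n v}"
  by (rule finite_subset[of _ "{1..n}"]; auto simp: edges_def face_diagonals_def inner_diagonals_def segments_def)+

lemma segments_partition:
  assumes "i \<in> {1..n}"
  shows "(\<Sum>k\<in>{1..n} - {i}. h k) = (\<Sum>k | (i, k) \<in> edges T n v. h k) +
    (\<Sum>k | (i, k) \<in> face_diagonals T n v. h k) + (\<Sum>k | (i, k) \<in> inner_diagonals T n v. h k)"
proof -
  have "{1..n} - {i} = ({k. (i, k) \<in> edges T n v} \<union> {k. (i, k) \<in> face_diagonals T n v}) \<union> {k. (i, k) \<in> inner_diagonals T n v}"
    using assms by (auto simp: edges_def face_diagonals_def inner_diagonals_def segments_def)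
  moreover have "{k. (i, k) \<in> edges T n v} \<inter> {k. (i, k) \<in> face_diagonals T n v} = {}"
    "({k. (i, k) \<in> edges T n v} \<union> {k. (i, k) \<in> face_diagonals T n v}) \<inter> {k. (i, k) \<in> inner_diagonals T n v} = {}"
    by (auto simp: face_diagonals_def inner_diagonals_def)
  ultimately show ?thesis
    by (simp add: sum.union_disjoint)
qed

text \<open>In this form the condition is symmetric in the three vertices, which lets sides and
  diagonals exchange roles below.\<close>

lemma edge_nbhd_iff:
  assumes "i \<in> {1..n}" "j \<in> {1..n}"
  shows "k \<in> edge_nbhd T n v i j \<longleftrightarrow> (\<exists>f\<in>faces T. {i, j, k} \<subseteq> face_verts n v f)"
proof -
  have "closed_segment (v i) (v j) \<subseteq> f \<longleftrightarrow> {i, j} \<subseteq> face_verts n v f" if "f \<in> faces T" for f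
    using assms closed_segment_subset[OF _ _ facesD(4)[OF that]] by (auto simp: face_verts_def)
  then show ?thesis
    unfolding edge_nbhd_def by auto
qed

section \<open>Edges and diagonals within the facets\<close>

lemma face_diagonalD:
  assumes "(i, k) \<in> face_diagonals T n v"
  shows "i \<in> {1..n}" "k \<in> {1..n}" "i \<noteq> k" "(i, k) \<notin> edges T n v" "closed_segment (v i) (v k) \<subseteq> frontier T"
  using assms by (auto simp: face_diagonals_def segments_def)

lemma face_diagonal_unique_facet:
  assumes ik: "(i, k) \<in> face_diagonals T n v" and fg: "f \<in> faces T" "g \<in> faces T"
    and "{i, k} \<subseteq> face_verts n v f" "{i, k} \<subseteq> face_verts n v g"
  shows "f = g"
proof (rule ccontr)
  assume ne: "f \<noteq> g"
  have "v i \<in> f \<inter> g" "v k \<in> f \<inter> g"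
    using assms(4,5) by (simp_all add: face_verts_def)
  then have "(i, k) \<in> edges T n v"
    by (rule facets_meet_in_edge(1)[OF fg ne face_diagonalD(1-3)[OF ik]])
  then show False
    using face_diagonalD(4)[OF ik] by simp
qed

lemma par_edges:
  assumes "par f i a k b"
  shows "(i, a) \<in> edges T n v" "(a, k) \<in> edges T n v" "(k, b) \<in> edges T n v" "(b, i) \<in> edges T n v"
    "(i, b) \<in> edges T n v"
proof -
  have bd: "face_bdry T n v f = {(i, a), (a, k), (k, b), (b, i)}"
    using assms by (simp add: par_def)
  have "face_bdry T n v f \<subseteq> edges T n v"
    by (auto simp: face_bdry_def)
  then show "(i, a) \<in> edges T n v" "(a, k) \<in> edges T n v" "(k, b) \<in> edges T n v" "(b, i) \<in> edges T n v"
    "(i, b) \<in> edges T n v"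
    unfolding bd using edges_sym[of b i T n v] by simp_all
qed

lemma tri_edges:
  assumes "tri f i a b"
  shows "(i, a) \<in> edges T n v" "(a, b) \<in> edges T n v" "(b, i) \<in> edges T n v" "(i, b) \<in> edges T n v"
    "(b, a) \<in> edges T n v"
proof -
  have bd: "face_bdry T n v f = {(i, a), (a, b), (b, i)}"
    using assms by (simp add: tri_def)
  have "face_bdry T n v f \<subseteq> edges T n v"
    by (auto simp: face_bdry_def)
  then show "(i, a) \<in> edges T n v" "(a, b) \<in> edges T n v" "(b, i) \<in> edges T n v" "(i, b) \<in> edges T n v"
    "(b, a) \<in> edges T n v"
    unfolding bd using edges_sym[of b i T n v] edges_sym[of a b T n v] by simp_all
qed

text \<open>Both ends lie in one facet. In a triangle they would span an edge, so the facet is a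
  parallelogram with k opposite to i, and the diagonal is the sum of the sides at i. No other edge
  at i has k in its neighbourhood, because only one facet contains both i and k.\<close>

lemma face_diagonal_structure:
  assumes ik: "(i, k) \<in> face_diagonals T n v"
  obtains a b where "a \<noteq> b" "{j. (i, j) \<in> edges T n v \<and> k \<in> edge_nbhd T n v i j} = {a, b}"
    "tau v i k = tau v i a + tau v i b"
proof -
  note D = face_diagonalD[OF ik]
  obtain f where f: "f \<in> faces T" "v i \<in> f" "v k \<in> f"
    using frontier_segment_in_facet[OF D(5)] D v_eq_iff by blast
  then have ikf: "{i, k} \<subseteq> face_verts n v f"
    using D by (simp add: face_verts_def)
  then have "i \<in> face_verts n v f"
    by simp
  with f(1) show ?thesis
  proof (cases rule: face_cases)
    case (tri a b)
    then have "k = a \<or> k = b"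
      using ikf D(3) unfolding tri_def by auto
    then show ?thesis
      using tri_edges[OF tri] D(4) by blast
  next
    case (par a c b)
    then have vs: "face_verts n v f = {i, a, c, b}" and d: "distinct [i, a, c, b]" and sum: "v i + v c = v a + v b"
      unfolding par_def by simp_all
    have kc: "k = c"
      using vs ikf D(3,4) par_edges[OF par] by auto
    have "j \<in> {a, b} \<longleftrightarrow> (i, j) \<in> edges T n v \<and> k \<in> edge_nbhd T n v i j" for j
    proof
      assume "j \<in> {a, b}"
      moreover from this have e: "(i, j) \<in> edges T n v"
        using par_edges[OF par] by blast
      ultimately show "(i, j) \<in> edges T n v \<and> k \<in> edge_nbhd T n v i j"
        using edge_nbhd_iff[OF edgeD(1,2)[OF e]] f(1) vs kc by auto
    next
      assume j: "(i, j) \<in> edges T n v \<and> k \<in> edge_nbhd T n v i j"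
      then obtain g where g: "g \<in> faces T" "{i, j, k} \<subseteq> face_verts n v g"
        using edge_nbhd_iff[OF edgeD(1,2)[of i j]] by blast
      then have "g = f"
        using face_diagonal_unique_facet[OF ik f(1) g(1) ikf] by blast
      then have "j \<in> {i, a, c, b}"
        using g vs by blast
      moreover have "j \<noteq> i" "j \<noteq> c"
        using j edgeD(3) D(4) kc by blast+
      ultimately show "j \<in> {a, b}"
        by blast
    qed
    then have "{j. (i, j) \<in> edges T n v \<and> k \<in> edge_nbhd T n v i j} = {a, b}"
      by blast
    moreover have "tau v i k = tau v i a + tau v i b"
      using sum kc by (simp add: tau_def algebra_simps)
    ultimately show ?thesis
      using that[of a b] d by simp
  qed
qed

text \<open>Here the diagonal from i to k cuts off the corner j of a parallelogram, a situation
  symmetric in i and k. This symmetry drives the cancellation around a vertex.\<close>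

lemma corner_diagonal_sym:
  assumes ij: "(j, i) \<in> edges T n v" and k: "k \<in> edge_nbhd T n v i j" "(i, k) \<in> face_diagonals T n v"
  shows "(j, k) \<in> edges T n v \<and> i \<in> edge_nbhd T n v k j \<and> (k, i) \<in> face_diagonals T n v"
proof -
  note D = face_diagonalD[OF k(2)] and E = edgeD(1,2,3)[OF ij]
  obtain f where f: "f \<in> faces T" "{i, j, k} \<subseteq> face_verts n v f"
    using edge_nbhd_iff[OF E(2,1)] k(1) by blast
  then have "j \<in> face_verts n v f"
    by simp
  have "k \<noteq> j"
    using ij edges_sym[of i j T n v] D(4) by blast
  from f(1) \<open>j \<in> face_verts n v f\<close> have "(j, k) \<in> edges T n v"
  proof (cases rule: face_cases)
    case (tri a b)
    then have "k = a \<or> k = b"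
      using f(2) \<open>k \<noteq> j\<close> unfolding tri_def by auto
    then show ?thesis
      using tri_edges[OF tri] by blast
  next
    case (par a c b)
    then have vs: "face_verts n v f = {j, a, c, b}" and nc: "(j, c) \<notin> edges T n v"
      unfolding par_def by simp_all
    have "i \<noteq> c"
      using ij nc by blast
    then have "i = a \<or> i = b"
      using f(2) vs E(3) by auto
    then have "k \<noteq> c"
      using par_edges[OF par] D(4) edges_sym[of b c T n v] by blast
    then have "k = a \<or> k = b"
      using f(2) vs \<open>k \<noteq> j\<close> by auto
    then show ?thesis
      using par_edges[OF par] by blast
  qed
  moreover have "i \<in> edge_nbhd T n v k j"
    using edge_nbhd_iff[OF D(2) E(1)] f by blast
  ultimately show ?thesis
    using k(2) face_diagonals_sym[of i k T n v] by blast
qed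

section \<open>Summation over directed edges\<close>

lemma sum_edges: "sum g (edges T n v) = (\<Sum>i\<in>{1..n}. \<Sum>j | (i, j) \<in> edges T n v. g (i, j))"
  by (rule sum_pairs[OF finite_edges edges_fst]) simp

lemma sum_edges_swap: "(\<Sum>(i, j)\<in>edges T n v. g j i) = (\<Sum>(i, j)\<in>edges T n v. g i j)"
  by (rule sum.reindex_bij_witness[of _ prod.swap prod.swap]) (use edges_sym[of _ _ T n v] in auto)

text \<open>A diagonal is met once from each of its two sides at i, and these sides add up to it, so
  the linear weights add up too.\<close>

lemma sum_over_diagonal_neighbours:
  fixes h :: "real^3 \<Rightarrow> real" and W :: "nat \<Rightarrow> 'a::real_vector"
  assumes h: "linear h"
  shows "(\<Sum>j | (i, j) \<in> edges T n v. \<Sum>k | k \<in> edge_nbhd T n v i j \<and> (i, k) \<in> face_diagonals T n v. h (tau v i j) *\<^sub>R W k)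
    = (\<Sum>k | (i, k) \<in> face_diagonals T n v. h (tau v i k) *\<^sub>R W k)"
proof -
  have "(\<Sum>j | (i, j) \<in> edges T n v. \<Sum>k | k \<in> edge_nbhd T n v i j \<and> (i, k) \<in> face_diagonals T n v. h (tau v i j) *\<^sub>R W k)
     = (\<Sum>j\<in>{j. (i, j) \<in> edges T n v}. \<Sum>k | k \<in> {k. (i, k) \<in> face_diagonals T n v} \<and> k \<in> edge_nbhd T n v i j. h (tau v i j) *\<^sub>R W k)"
    by (simp add: conj_commute)
  also have "\<dots> = (\<Sum>k\<in>{k. (i, k) \<in> face_diagonals T n v}. \<Sum>j | j \<in> {j. (i, j) \<in> edges T n v} \<and> k \<in> edge_nbhd T n v i j. h (tau v i j) *\<^sub>R W k)"
    by (rule sum.swap_restrict) simp_all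
  also have "\<dots> = (\<Sum>k\<in>{k. (i, k) \<in> face_diagonals T n v}. h (tau v i k) *\<^sub>R W k)"
  proof (rule sum.cong[OF refl])
    fix k assume "k \<in> {k. (i, k) \<in> face_diagonals T n v}"
    then obtain a b where ab: "a \<noteq> b" "{j. (i, j) \<in> edges T n v \<and> k \<in> edge_nbhd T n v i j} = {a, b}"
      "tau v i k = tau v i a + tau v i b"
      using face_diagonal_structure[of i k] by blast
    then show "(\<Sum>j | j \<in> {j. (i, j) \<in> edges T n v} \<and> k \<in> edge_nbhd T n v i j. h (tau v i j) *\<^sub>R W k) = h (tau v i k) *\<^sub>R W k"
      by (simp add: linear_add[OF h] scaleR_left_distrib)
  qed
  finally show ?thesis by simp
qed

lemma sum_over_inner_representation:
  fixes h :: "real^3 \<Rightarrow> real" and W :: "nat \<Rightarrow> 'a::real_vector"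
  assumes h: "linear h" and C: "diagonal_coeffs T n v C"
  shows "(\<Sum>j | (i, j) \<in> edges T n v. \<Sum>k | (i, k) \<in> inner_diagonals T n v. h (tau v i j) *\<^sub>R C i k j *\<^sub>R W k)
    = (\<Sum>k | (i, k) \<in> inner_diagonals T n v. h (tau v i k) *\<^sub>R W k)"
proof -
  have "(\<Sum>j | (i, j) \<in> edges T n v. \<Sum>k | (i, k) \<in> inner_diagonals T n v. h (tau v i j) *\<^sub>R C i k j *\<^sub>R W k)
     = (\<Sum>k | (i, k) \<in> inner_diagonals T n v. \<Sum>j | (i, j) \<in> edges T n v. h (tau v i j) *\<^sub>R C i k j *\<^sub>R W k)"
    by (rule sum.swap)
  also have "\<dots> = (\<Sum>k | (i, k) \<in> inner_diagonals T n v. h (tau v i k) *\<^sub>R W k)"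
  proof (rule sum.cong[OF refl])
    fix k assume "k \<in> {k. (i, k) \<in> inner_diagonals T n v}"
    then have "tau v i k = (\<Sum>j | (i, j) \<in> edges T n v. C i k j *\<^sub>R tau v i j)"
      using C unfolding diagonal_coeffs_def by blast
    then have "h (tau v i k) = (\<Sum>j | (i, j) \<in> edges T n v. h (tau v i j) * C i k j)"
      by (simp add: linear_sum[OF h] linear_scale[OF h] mult.commute)
    then show "(\<Sum>j | (i, j) \<in> edges T n v. h (tau v i j) *\<^sub>R C i k j *\<^sub>R W k) = h (tau v i k) *\<^sub>R W k"
      by (simp add: scaleR_sum_left)
  qed
  finally show ?thesis .
qed

text \<open>The combined array is half of \<open>P i j - P j i\<close>, where P collects the terms
  starting at its first index. The weights change sign with direction, so both halves contribute
  equally; at a fixed i, linearity of the weight turns sums over edges into sums over the diagonals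
  that they represent.\<close>

lemma sum_edges_combine:
  fixes B :: "nat \<Rightarrow> real^3 \<Rightarrow> real" and W :: "nat \<Rightarrow> nat \<Rightarrow> 'a::real_vector"
  assumes C: "diagonal_coeffs T n v C"
    and lin: "\<And>i. linear (B i)" and B: "\<And>i j. B j (tau v j i) = - B i (tau v i j)"
    and W: "\<And>i j. W j i = - W i j"
  shows "(\<Sum>(i, j)\<in>edges T n v. B i (tau v i j) *\<^sub>R combine T n v C W i j)
    = (\<Sum>i\<in>{1..n}. \<Sum>k\<in>{1..n}. B i (tau v i k) *\<^sub>R W i k)"
proof -
  define P where "P i j = W i j + (\<Sum>k | k \<in> edge_nbhd T n v i j \<and> (i, k) \<in> face_diagonals T n v. W i k)
      + (\<Sum>k | (i, k) \<in> inner_diagonals T n v. C i k j *\<^sub>R W i k)" for i j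
  let ?c = "\<lambda>i j. B i (tau v i j)"
  have half: "x + (1/2) *\<^sub>R (a - b) + (1/2) *\<^sub>R (c - d) = (1/2) *\<^sub>R ((x + a + c) - (- x + b + d))" for a b c d x :: 'a
  proof -
    have "(1/2) *\<^sub>R (x + x) + (1/2) *\<^sub>R (a - b) + (1/2) *\<^sub>R (c - d) = (1/2) *\<^sub>R ((x + a + c) - (- x + b + d))"
      by (simp only: scaleR_right_distrib[symmetric]) (simp add: algebra_simps)
    then show ?thesis by simp
  qed
  have comb: "combine T n v C W i j = (1/2) *\<^sub>R (P i j - P j i)" for i j
    unfolding combine_def P_def edge_nbhd_commute[of T n v j i] W[of j i] by (rule half)
  have "(\<Sum>(i, j)\<in>edges T n v. ?c i j *\<^sub>R combine T n v C W i j)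
      = (\<Sum>(i, j)\<in>edges T n v. (1/2) *\<^sub>R (?c i j *\<^sub>R P i j) + (1/2) *\<^sub>R (?c j i *\<^sub>R P j i))"
  proof (rule sum.cong[OF refl], clarify)
    fix i j
    have "?c j i = - ?c i j"
      by (rule B)
    then show "?c i j *\<^sub>R combine T n v C W i j = (1/2) *\<^sub>R (?c i j *\<^sub>R P i j) + (1/2) *\<^sub>R (?c j i *\<^sub>R P j i)"
      by (simp add: comb algebra_simps)
  qed
  also have "\<dots> = (1/2) *\<^sub>R (\<Sum>(i, j)\<in>edges T n v. ?c i j *\<^sub>R P i j) + (1/2) *\<^sub>R (\<Sum>(i, j)\<in>edges T n v. ?c j i *\<^sub>R P j i)"
    by (simp add: case_prod_beta sum.distrib scaleR_right.sum)
  also have "\<dots> = (\<Sum>(i, j)\<in>edges T n v. ?c i j *\<^sub>R P i j)"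
    unfolding sum_edges_swap[of "\<lambda>i j. ?c i j *\<^sub>R P i j"] by (simp add: scaleR_left_distrib[symmetric])
  also have "\<dots> = (\<Sum>i\<in>{1..n}. \<Sum>k\<in>{1..n}. ?c i k *\<^sub>R W i k)"
    unfolding sum_edges prod.case
  proof (rule sum.cong[OF refl])
    fix i assume i: "i \<in> {1..n}"
    have "(\<Sum>j | (i, j) \<in> edges T n v. ?c i j *\<^sub>R P i j) =
       (\<Sum>j | (i, j) \<in> edges T n v. ?c i j *\<^sub>R W i j) +
       (\<Sum>j | (i, j) \<in> edges T n v. \<Sum>k | k \<in> edge_nbhd T n v i j \<and> (i, k) \<in> face_diagonals T n v. ?c i j *\<^sub>R W i k) +
       (\<Sum>j | (i, j) \<in> edges T n v. \<Sum>k | (i, k) \<in> inner_diagonals T n v. ?c i j *\<^sub>R C i k j *\<^sub>R W i k)"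
      unfolding P_def by (simp only: scaleR_right_distrib sum.distrib scaleR_right.sum)
    also have "\<dots> = (\<Sum>k\<in>{1..n} - {i}. ?c i k *\<^sub>R W i k)"
      unfolding sum_over_diagonal_neighbours[OF lin] sum_over_inner_representation[OF lin C] segments_partition[OF i] ..
    also have "\<dots> = (\<Sum>k\<in>{1..n}. ?c i k *\<^sub>R W i k)"
      by (rule sum.mono_neutral_left) (use linear_0[OF lin] in \<open>auto simp: tau_def\<close>)
    finally show "(\<Sum>j | (i, j) \<in> edges T n v. ?c i j *\<^sub>R P i j) = (\<Sum>k\<in>{1..n}. ?c i k *\<^sub>R W i k)" .
  qed
  finally show ?thesis .
qed

text \<open>The diagonals that cut off the corner at j occur in both directions and cancel. Each
  diagonal from j is met from two sides, and the factor 1/2 leaves one copy of it.\<close>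

lemma sum_star_combine:
  fixes W :: "nat \<Rightarrow> nat \<Rightarrow> 'a::real_vector"
  assumes I: "inner_diagonals T n v = {}" and W: "\<And>i j. W j i = - W i j" and j: "j \<in> {1..n}"
  shows "(\<Sum>i | (j, i) \<in> edges T n v. combine T n v C W i j) = (\<Sum>i\<in>{1..n}. W i j)"
proof -
  let ?N = "{i. (j, i) \<in> edges T n v}" and ?D = "{k. (j, k) \<in> face_diagonals T n v}"
  have first: "(\<Sum>i\<in>?N. \<Sum>k | k \<in> edge_nbhd T n v i j \<and> (i, k) \<in> face_diagonals T n v. W i k) = 0"
  proof -
    let ?S = "Sigma ?N (\<lambda>i. {k. k \<in> edge_nbhd T n v i j \<and> (i, k) \<in> face_diagonals T n v})"
    have fin: "finite {k. k \<in> edge_nbhd T n v i j \<and> (i, k) \<in> face_diagonals T n v}" for i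
      by (rule finite_subset[OF _ finite_pairs_from(2)[of i]]) blast
    have "(\<Sum>i\<in>?N. \<Sum>k | k \<in> edge_nbhd T n v i j \<and> (i, k) \<in> face_diagonals T n v. W i k) = (\<Sum>(i, k)\<in>?S. W i k)"
      by (rule sum.Sigma) (use fin in auto)
    also have "\<dots> = 0"
    proof (rule sum_antisym_eq_0)
      fix i k
      show "(case (k, i) of (i, k) \<Rightarrow> W i k) = - (case (i, k) of (i, k) \<Rightarrow> W i k)"
        unfolding prod.case by (rule W)
      show "(i, k) \<in> ?S \<longleftrightarrow> (k, i) \<in> ?S"
        using corner_diagonal_sym[of j i k] corner_diagonal_sym[of j k i] by auto
    qed
    finally show ?thesis .
  qed
  have second: "(\<Sum>i\<in>?N. \<Sum>k | k \<in> edge_nbhd T n v i j \<and> (j, k) \<in> face_diagonals T n v. W j k) = 2 *\<^sub>R (\<Sum>k\<in>?D. W j k)"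
  proof -
    have "(\<Sum>i\<in>?N. \<Sum>k | k \<in> edge_nbhd T n v i j \<and> (j, k) \<in> face_diagonals T n v. W j k)
       = (\<Sum>i\<in>?N. \<Sum>k | k \<in> ?D \<and> k \<in> edge_nbhd T n v j i. W j k)"
      by (simp add: conj_commute edge_nbhd_commute[of T n v _ j])
    also have "\<dots> = (\<Sum>k\<in>?D. \<Sum>i | i \<in> ?N \<and> k \<in> edge_nbhd T n v j i. W j k)"
      by (rule sum.swap_restrict) simp_all
    also have "\<dots> = (\<Sum>k\<in>?D. 2 *\<^sub>R W j k)"
    proof (rule sum.cong[OF refl])
      fix k assume "k \<in> ?D"
      then have "(j, k) \<in> face_diagonals T n v"
        by simp
      then obtain a b where "a \<noteq> b" "{i. (j, i) \<in> edges T n v \<and> k \<in> edge_nbhd T n v j i} = {a, b}"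
        by (rule face_diagonal_structure)
      then show "(\<Sum>i | i \<in> ?N \<and> k \<in> edge_nbhd T n v j i. W j k) = 2 *\<^sub>R W j k"
        by (simp add: scaleR_2)
    qed
    finally show ?thesis
      by (simp add: scaleR_right.sum)
  qed
  have expand: "(\<Sum>i\<in>?N. combine T n v C W i j) = (\<Sum>i\<in>?N. W i j)
      + (1/2) *\<^sub>R ((\<Sum>i\<in>?N. \<Sum>k | k \<in> edge_nbhd T n v i j \<and> (i, k) \<in> face_diagonals T n v. W i k)
        - (\<Sum>i\<in>?N. \<Sum>k | k \<in> edge_nbhd T n v i j \<and> (j, k) \<in> face_diagonals T n v. W j k))"
    using I by (simp add: combine_def sum.distrib) (simp only: scaleR_right.sum[symmetric] sum_subtractf)
  have neg: "(\<Sum>k\<in>?D. W k j) = (\<Sum>k\<in>?D. - W j k)"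
    by (rule sum.cong[OF refl]) (rule W)
  note expand
  also have "(\<Sum>i\<in>?N. W i j)
      + (1/2) *\<^sub>R ((\<Sum>i\<in>?N. \<Sum>k | k \<in> edge_nbhd T n v i j \<and> (i, k) \<in> face_diagonals T n v. W i k)
        - (\<Sum>i\<in>?N. \<Sum>k | k \<in> edge_nbhd T n v i j \<and> (j, k) \<in> face_diagonals T n v. W j k))
      = (\<Sum>i\<in>?N. W i j) + (\<Sum>k\<in>?D. W k j)"
    unfolding first second neg by (simp add: sum_negf)
  also have "\<dots> = (\<Sum>i\<in>{1..n} - {j}. W i j)"
    using segments_partition[OF j, of "\<lambda>i. W i j"] I by simp
  also have "\<dots> = (\<Sum>i\<in>{1..n}. W i j)"
  proof (rule sum.mono_neutral_left)
    have "2 *\<^sub>R W j j = 0"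
      using W[of j j] by (simp add: scaleR_2 eq_neg_iff_add_eq_0)
    then show "\<forall>i\<in>{1..n} - ({1..n} - {j}). W i j = 0"
      by auto
  qed auto
  finally show ?thesis .
qed

text \<open>The boundary of f as an antisymmetric chain on directed edges. Since
  \<open>edges T n v\<close> holds every edge in both directions, pairings with it come out
  doubled.\<close>

definition bdry_sign :: "(real^3) set \<Rightarrow> nat \<times> nat \<Rightarrow> real" where
  "bdry_sign f e = of_bool (e \<in> face_bdry T n v f) - of_bool (prod.swap e \<in> face_bdry T n v f)"

lemma face_bdry_subset: "face_bdry T n v f \<subseteq> edges T n v"
  by (auto simp: face_bdry_def)

lemma sum_bdry_sign:
  fixes g :: "nat \<Rightarrow> nat \<Rightarrow> 'a::real_vector"
  assumes g: "\<And>i j. g j i = - g i j"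
  shows "(\<Sum>(i, j)\<in>edges T n v. bdry_sign f (i, j) *\<^sub>R g i j) = 2 *\<^sub>R (\<Sum>(i, j)\<in>face_bdry T n v f. g i j)"
proof -
  have pos: "(\<Sum>(i, j)\<in>edges T n v. of_bool ((i, j) \<in> face_bdry T n v f) *\<^sub>R g i j) = (\<Sum>(i, j)\<in>face_bdry T n v f. g i j)"
    by (rule sum.mono_neutral_cong_right[OF finite_edges face_bdry_subset]) auto
  have "(\<Sum>(i, j)\<in>edges T n v. bdry_sign f (i, j) *\<^sub>R g i j) =
     (\<Sum>(i, j)\<in>edges T n v. of_bool ((i, j) \<in> face_bdry T n v f) *\<^sub>R g i j) +
     (\<Sum>(i, j)\<in>edges T n v. of_bool ((j, i) \<in> face_bdry T n v f) *\<^sub>R g j i)"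
    unfolding sum.distrib[symmetric] case_prod_beta
  proof (rule sum.cong[OF refl])
    fix e :: "nat \<times> nat"
    show "bdry_sign f (fst e, snd e) *\<^sub>R g (fst e) (snd e) =
      of_bool ((fst e, snd e) \<in> face_bdry T n v f) *\<^sub>R g (fst e) (snd e) +
      of_bool ((snd e, fst e) \<in> face_bdry T n v f) *\<^sub>R g (snd e) (fst e)"
      using g[of "snd e" "fst e"] by (cases e) (simp add: bdry_sign_def scaleR_left_diff_distrib)
  qed
  also have "(\<Sum>(i, j)\<in>edges T n v. of_bool ((j, i) \<in> face_bdry T n v f) *\<^sub>R g j i) =
      (\<Sum>(i, j)\<in>edges T n v. of_bool ((i, j) \<in> face_bdry T n v f) *\<^sub>R g i j)"
    by (rule sum_edges_swap)
  finally show ?thesis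
    unfolding pos by (simp add: scaleR_2)
qed

text \<open>Discrete integration by parts; the inner sum on the right is the net inflow of g at
  j.\<close>

lemma sum_potential_edges:
  fixes g :: "nat \<Rightarrow> nat \<Rightarrow> 'a::real_vector"
  assumes g: "\<And>i j. g j i = - g i j"
  shows "(\<Sum>(i, j)\<in>edges T n v. (p j - p i) *\<^sub>R g i j) = 2 *\<^sub>R (\<Sum>j\<in>{1..n}. p j *\<^sub>R (\<Sum>i | (j, i) \<in> edges T n v. g i j))"
proof -
  have "(\<Sum>(i, j)\<in>edges T n v. (p j - p i) *\<^sub>R g i j) =
      (\<Sum>(i, j)\<in>edges T n v. p j *\<^sub>R g i j) + (\<Sum>(i, j)\<in>edges T n v. p i *\<^sub>R g j i)"
    unfolding sum.distrib[symmetric] case_prod_beta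
  proof (rule sum.cong[OF refl])
    fix e :: "nat \<times> nat"
    show "(p (snd e) - p (fst e)) *\<^sub>R g (fst e) (snd e) = p (snd e) *\<^sub>R g (fst e) (snd e) + p (fst e) *\<^sub>R g (snd e) (fst e)"
      using g[of "snd e" "fst e"] by (simp add: scaleR_left_diff_distrib)
  qed
  also have "(\<Sum>(i, j)\<in>edges T n v. p j *\<^sub>R g i j) = (\<Sum>(i, j)\<in>edges T n v. p i *\<^sub>R g j i)"
    using sum_edges_swap[of "\<lambda>i j. p i *\<^sub>R g j i"] .
  also have "(\<Sum>(i, j)\<in>edges T n v. p i *\<^sub>R g j i) = (\<Sum>j\<in>{1..n}. p j *\<^sub>R (\<Sum>i | (j, i) \<in> edges T n v. g i j))"
    unfolding sum_edges by (simp add: scaleR_right.sum)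
  finally show ?thesis
    by (simp add: scaleR_2)
qed

text \<open>The order of the quantifiers matters: y and p are fixed before W. The arrays used later
  depend on the point x, and one choice of coefficients must serve all points, for the forms as well
  as for their curls.\<close>

lemma rotation_chain_spanned:
  assumes C: "diagonal_coeffs T n v C"
    and type: "inner_diagonals T n v = {} \<or>
      (\<forall>i\<in>{1..n}. cross3 (o' - v i) (\<Sum>j | (i, j) \<in> edges T n v. tau v i j) = 0)"
  shows "\<exists>y p. \<forall>W :: nat \<Rightarrow> nat \<Rightarrow> 'a::real_vector. (\<forall>i j. W j i = - W i j) \<longrightarrow>
    (\<Sum>i\<in>{1..n}. \<Sum>k\<in>{1..n}. (a \<bullet> cross3 (v i - o') (v k - o')) *\<^sub>R W i k) =
    2 *\<^sub>R (\<Sum>f\<in>faces T. y f *\<^sub>R (\<Sum>(i, j)\<in>face_bdry T n v f. combine T n v C W i j)) +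
    2 *\<^sub>R (\<Sum>j\<in>{1..n}. p j *\<^sub>R (\<Sum>i\<in>{1..n}. W i j))"
proof -
  define B where "B i u = a \<bullet> cross3 (v i - o') u" for i u
  define c where "c e = a \<bullet> cross3 (v (fst e) - o') (v (snd e) - o')" for e
  have lin: "linear (B i)" for i
    unfolding B_def by (rule linearI) (simp_all add: cross_add_right cross_mult_right inner_add_right)
  \<comment> \<open>The vectors \<open>v j - o'\<close> and \<open>tau v i j\<close> differ by
    \<open>v i - o'\<close>, which the cross product kills.\<close>
  have cB: "c (i, j) = B i (tau v i j)" for i j
    unfolding c_def B_def tau_def by (simp add: cross3_simps)
  have c_anti: "c (j, i) = - c (i, j)" for i j
    unfolding c_def using cross_skew[of "v j - o'"] by simp
  obtain y where y: "\<And>g. g \<in> faces T \<Longrightarrow>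
      (\<Sum>e\<in>edges T n v. (c e - (\<Sum>f\<in>faces T. y f * bdry_sign f e)) * bdry_sign g e) = 0"
    using orthogonal_decomposition[OF finite_faces finite_edges, of c bdry_sign] by blast
  define z where "z i j = c (i, j) - (\<Sum>f\<in>faces T. y f * bdry_sign f (i, j))" for i j
  have sign_anti: "bdry_sign f (j, i) = - bdry_sign f (i, j)" for f i j
    by (simp add: bdry_sign_def)
  have z_anti: "z j i = - z i j" for i j
    unfolding z_def c_anti[of j i] sign_anti[of _ j i] by (simp add: sum_negf)
  have z_orth: "(\<Sum>(i, j)\<in>edges T n v. bdry_sign g (i, j) *\<^sub>R z i j) = 0" if "g \<in> faces T" for g
    using y[OF that] by (simp add: z_def case_prod_beta mult.commute)
  have z_closed: "(\<Sum>(i, j)\<in>face_bdry T n v g. z i j) = 0" if "g \<in> faces T" for g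
    using z_orth[OF that] sum_bdry_sign[of z g, OF z_anti] by simp
  obtain p where p: "\<And>i j. (i, j) \<in> edges T n v \<Longrightarrow> z i j = p j - p i"
    using closed_cochain_exact[OF z_anti z_closed] by blast
  \<comment> \<open>The value type stays generic, as this is applied to the combined array and also
    to the real cochain z itself.\<close>
  have split: "(\<Sum>(i, j)\<in>edges T n v. c (i, j) *\<^sub>R g i j) =
      2 *\<^sub>R (\<Sum>f\<in>faces T. y f *\<^sub>R (\<Sum>(i, j)\<in>face_bdry T n v f. g i j)) + (\<Sum>(i, j)\<in>edges T n v. z i j *\<^sub>R g i j)"
    if g: "\<And>i j. g j i = - g i j" for g :: "nat \<Rightarrow> nat \<Rightarrow> 'b::real_vector"
  proof -
    have "(\<Sum>(i, j)\<in>edges T n v. c (i, j) *\<^sub>R g i j) =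
      (\<Sum>(i, j)\<in>edges T n v. \<Sum>f\<in>faces T. y f *\<^sub>R (bdry_sign f (i, j) *\<^sub>R g i j)) + (\<Sum>(i, j)\<in>edges T n v. z i j *\<^sub>R g i j)"
      unfolding sum.distrib[symmetric] case_prod_beta
      by (rule sum.cong) (simp_all add: z_def scaleR_left_diff_distrib scaleR_sum_left)
    also have "(\<Sum>(i, j)\<in>edges T n v. \<Sum>f\<in>faces T. y f *\<^sub>R (bdry_sign f (i, j) *\<^sub>R g i j)) =
      (\<Sum>f\<in>faces T. y f *\<^sub>R (\<Sum>(i, j)\<in>edges T n v. bdry_sign f (i, j) *\<^sub>R g i j))"
      unfolding case_prod_beta by (subst sum.swap) (simp add: scaleR_right.sum)
    finally show ?thesis
      unfolding sum_bdry_sign[of g, OF g] by (simp add: scaleR_right.sum mult.commute)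
  qed
  have main: "\<exists>q. \<forall>W :: nat \<Rightarrow> nat \<Rightarrow> 'a. (\<forall>i j. W j i = - W i j) \<longrightarrow>
      (\<Sum>(i, j)\<in>edges T n v. z i j *\<^sub>R combine T n v C W i j) = 2 *\<^sub>R (\<Sum>j\<in>{1..n}. q j *\<^sub>R (\<Sum>i\<in>{1..n}. W i j))"
    using type
  proof
    assume I: "inner_diagonals T n v = {}"
    have "(\<Sum>(i, j)\<in>edges T n v. z i j *\<^sub>R combine T n v C W i j) = 2 *\<^sub>R (\<Sum>j\<in>{1..n}. p j *\<^sub>R (\<Sum>i\<in>{1..n}. W i j))"
      if W: "\<forall>i j. W j i = - W i j" for W :: "nat \<Rightarrow> nat \<Rightarrow> 'a"
    proof -
      have W: "W j i = - W i j" for i j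
        using W by blast
      have "(\<Sum>(i, j)\<in>edges T n v. z i j *\<^sub>R combine T n v C W i j) =
          (\<Sum>(i, j)\<in>edges T n v. (p j - p i) *\<^sub>R combine T n v C W i j)"
        by (rule sum.cong) (auto simp: p)
      also have "\<dots> = 2 *\<^sub>R (\<Sum>j\<in>{1..n}. p j *\<^sub>R (\<Sum>i | (j, i) \<in> edges T n v. combine T n v C W i j))"
        by (rule sum_potential_edges) (rule combine_antisym[OF W])
      also have "\<dots> = 2 *\<^sub>R (\<Sum>j\<in>{1..n}. p j *\<^sub>R (\<Sum>i\<in>{1..n}. W i j))"
        using sum_star_combine[of W, OF I W] by simp
      finally show ?thesis .
    qed
    then show ?thesis by blast
  next
    assume center: "\<forall>i\<in>{1..n}. cross3 (o' - v i) (\<Sum>j | (i, j) \<in> edges T n v. tau v i j) = 0"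
    \<comment> \<open>The center enters here: the cross product of \<open>v j - o'\<close> with the
      sum of the edge vectors at j vanishes.\<close>
    have div: "(\<Sum>i | (j, i) \<in> edges T n v. c (i, j)) = 0" if j: "j \<in> {1..n}" for j
    proof -
      have "(\<Sum>i | (j, i) \<in> edges T n v. c (i, j)) = - B j (\<Sum>i | (j, i) \<in> edges T n v. tau v j i)"
        unfolding c_anti[of _ j] cB[of j] by (simp add: linear_sum[OF lin] sum_negf)
      also have "v j - o' = - (o' - v j)"
        by simp
      then have "B j (\<Sum>i | (j, i) \<in> edges T n v. tau v j i) = 0"
        using center j unfolding B_def by (simp only: cross_minus_left) simp
      finally show ?thesis by simp
    qed
    \<comment> \<open>Pairing with z kills the boundary part, so c and z have the same pairing with
      z. But z is a coboundary and c is divergence free, so this pairing is 0 and z has norm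
      0.\<close>
    have "(\<Sum>(i, j)\<in>edges T n v. c (i, j) *\<^sub>R z i j) = (\<Sum>(i, j)\<in>edges T n v. z i j *\<^sub>R z i j)"
      using split[of z, OF z_anti] z_closed by simp
    moreover have "(\<Sum>(i, j)\<in>edges T n v. c (i, j) *\<^sub>R z i j) = (\<Sum>(i, j)\<in>edges T n v. (p j - p i) *\<^sub>R c (i, j))"
      by (rule sum.cong) (auto simp: p mult.commute)
    moreover have "\<dots> = 0"
      using sum_potential_edges[of "\<lambda>i j. c (i, j)" p, OF c_anti] div by simp
    ultimately have "(\<Sum>e\<in>edges T n v. z (fst e) (snd e) * z (fst e) (snd e)) = 0"
      by (simp add: case_prod_beta)
    then have "\<forall>e\<in>edges T n v. z (fst e) (snd e) = 0"
      using sum_nonneg_eq_0_iff[of "edges T n v" "\<lambda>e. z (fst e) (snd e) * z (fst e) (snd e)", OF finite_edges] by simp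
    then have zero: "(\<Sum>(i, j)\<in>edges T n v. z i j *\<^sub>R combine T n v C W i j) = 0" for W :: "nat \<Rightarrow> nat \<Rightarrow> 'a"
      by (intro sum.neutral) auto
    show ?thesis
    proof (rule exI[of _ "\<lambda>_. 0"], intro allI impI)
      fix W :: "nat \<Rightarrow> nat \<Rightarrow> 'a"
      show "(\<Sum>(i, j)\<in>edges T n v. z i j *\<^sub>R combine T n v C W i j) = 2 *\<^sub>R (\<Sum>j\<in>{1..n}. 0 *\<^sub>R (\<Sum>i\<in>{1..n}. W i j))"
        unfolding zero by simp
    qed
  qed
  then obtain q where q: "\<And>W :: nat \<Rightarrow> nat \<Rightarrow> 'a. \<forall>i j. W j i = - W i j \<Longrightarrow>
      (\<Sum>(i, j)\<in>edges T n v. z i j *\<^sub>R combine T n v C W i j) = 2 *\<^sub>R (\<Sum>j\<in>{1..n}. q j *\<^sub>R (\<Sum>i\<in>{1..n}. W i j))"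
    by blast
  show ?thesis
  proof (intro exI allI impI)
    fix W :: "nat \<Rightarrow> nat \<Rightarrow> 'a"
    assume W: "\<forall>i j. W j i = - W i j"
    then have W': "W j i = - W i j" for i j
      by blast
    have "(\<Sum>i\<in>{1..n}. \<Sum>k\<in>{1..n}. c (i, k) *\<^sub>R W i k) = (\<Sum>(i, j)\<in>edges T n v. c (i, j) *\<^sub>R combine T n v C W i j)"
      unfolding cB by (rule sum_edges_combine[of C B W, OF C lin _ W', symmetric]) (rule c_anti[unfolded cB])
    also have "\<dots> = 2 *\<^sub>R (\<Sum>f\<in>faces T. y f *\<^sub>R (\<Sum>(i, j)\<in>face_bdry T n v f. combine T n v C W i j)) +
        2 *\<^sub>R (\<Sum>j\<in>{1..n}. q j *\<^sub>R (\<Sum>i\<in>{1..n}. W i j))"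
      using split[of "combine T n v C W", OF combine_antisym[OF W']] q[OF W] by simp
    finally show "(\<Sum>i\<in>{1..n}. \<Sum>k\<in>{1..n}. (a \<bullet> cross3 (v i - o') (v k - o')) *\<^sub>R W i k) =
      2 *\<^sub>R (\<Sum>f\<in>faces T. y f *\<^sub>R (\<Sum>(i, j)\<in>face_bdry T n v f. combine T n v C W i j)) +
      2 *\<^sub>R (\<Sum>j\<in>{1..n}. q j *\<^sub>R (\<Sum>i\<in>{1..n}. W i j))"
      unfolding c_def by simp
  qed
qed

end

section \<open>Gradients relative to a convex set\<close>

text \<open>One-sided derivatives along segments of S make the difference of two gradients
  orthogonal to y - x for all y in S, even if x is a boundary point. As S contains a ball, the
  difference is 0.\<close>

lemma gradient_within_unique:
  fixes g :: "real^3 \<Rightarrow> real"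
  assumes S: "convex S" "interior S \<noteq> {}" "x \<in> S"
    and D: "(g has_derivative (\<lambda>h. D \<bullet> h)) (at x within S)"
    and D': "(g has_derivative (\<lambda>h. D' \<bullet> h)) (at x within S)"
  shows "D = D'"
proof -
  define E where "E = D - D'"
  have E: "((\<lambda>x. 0::real) has_derivative (\<lambda>h. E \<bullet> h)) (at x within S)"
    using has_derivative_diff[OF D D'] by (simp add: E_def inner_diff_left)
  have zero: "E \<bullet> (y - x) = 0" if y: "y \<in> S" for y
  proof -
    define c where "c t = x + t *\<^sub>R (y - x)" for t :: real
    have "c t \<in> S" if "t \<in> {0..1}" for t
      using convexD_alt[OF S(1,3) y, of t] that by (simp add: c_def algebra_simps)
    then have "c ` {0..1} \<subseteq> S" "c 0 = x"
      by (auto simp: c_def)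
    then have "((\<lambda>x. 0::real) has_derivative (\<lambda>h. E \<bullet> h)) (at (c 0) within c ` {0..1})"
      using has_derivative_subset[OF E] by simp
    moreover have "(c has_derivative (\<lambda>t. t *\<^sub>R (y - x))) (at 0 within {0..1})"
      unfolding c_def by (auto intro!: derivative_eq_intros)
    ultimately have "((\<lambda>t. 0::real) has_derivative (\<lambda>t. E \<bullet> (t *\<^sub>R (y - x)))) (at 0 within {0..1})"
      by (rule has_derivative_in_compose[rotated])
    then have "((\<lambda>t. 0::real) has_vector_derivative (E \<bullet> (y - x))) (at 0 within {0..1})"
      by (simp add: has_vector_derivative_def)
    moreover have "((\<lambda>t. 0::real) has_vector_derivative 0) (at 0 within {0..1})"
      by simp
    ultimately show ?thesis
      using vector_derivative_unique_within_closed_interval[of 0 1 0 "\<lambda>t. 0::real"] by (simp add: cbox_interval)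
  qed
  obtain z e where e: "e > 0" "ball z e \<subseteq> S"
    using S(2) by (metis ex_in_conv mem_interior)
  have "E = 0"
  proof (rule ccontr)
    assume "E \<noteq> 0"
    \<comment> \<open>A point of the ball at distance e/2 from its center in the direction of
      E.\<close>
    define w where "w = z + (e / (2 * norm E)) *\<^sub>R E"
    have "w \<in> S" "z \<in> S"
      using e \<open>E \<noteq> 0\<close> by (auto simp: w_def dist_norm subset_iff)
    then have "E \<bullet> (w - z) = 0"
      using zero[of w] zero[of z] by (simp add: inner_diff_right)
    then show False
      using e \<open>E \<noteq> 0\<close> by (simp add: w_def)
  qed
  then show ?thesis
    by (simp add: E_def)
qed

lemma grad_eqI:
  assumes "convex S" "interior S \<noteq> {}" "x \<in> S" "(g has_derivative (\<lambda>h. D \<bullet> h)) (at x within S)"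
  shows "grad S g x = D"
  unfolding grad_def by (rule the_equality[where a = D]) (use assms gradient_within_unique in blast)+

lemma C1_on_grad:
  assumes S: "convex S" "interior S \<noteq> {}" and g: "C1_on S g"
  shows "x \<in> S \<Longrightarrow> (g has_derivative (\<lambda>h. grad S g x \<bullet> h)) (at x within S)"
    and "continuous_on S (grad S g)"
proof -
  obtain G where G: "continuous_on S G" "\<And>x. x \<in> S \<Longrightarrow> (g has_derivative (\<lambda>h. G x \<bullet> h)) (at x within S)"
    using g unfolding C1_on_def by blast
  have eq: "grad S g x = G x" if "x \<in> S" for x
    using grad_eqI[OF S that G(2)[OF that]] .
  show "x \<in> S \<Longrightarrow> (g has_derivative (\<lambda>h. grad S g x \<bullet> h)) (at x within S)"
    using G(2) eq by simp
  show "continuous_on S (grad S g)"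
    using G(1) eq by (simp cong: continuous_on_cong)
qed

lemma C1_on_imp_continuous_on:
  assumes "C1_on S g"
  shows "continuous_on S g"
  using assms has_derivative_continuous unfolding C1_on_def continuous_on_eq_continuous_within by blast

lemma gradient_bound_imp_lipschitz:
  fixes g :: "real^3 \<Rightarrow> real"
  assumes "convex S" "\<And>x. x \<in> S \<Longrightarrow> (g has_derivative (\<lambda>h. G x \<bullet> h)) (at x within S)"
    and "\<And>x. x \<in> S \<Longrightarrow> norm (G x) \<le> B" "x \<in> S" "y \<in> S"
  shows "\<bar>g x - g y\<bar> \<le> B * norm (x - y)"
proof -
  have "onorm (\<lambda>h. G x \<bullet> h) \<le> B" if "x \<in> S" for x
  proof (rule onorm_le)
    fix h
    have "\<bar>G x \<bullet> h\<bar> \<le> norm (G x) * norm h"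
      by (rule Cauchy_Schwarz_ineq2)
    also have "\<dots> \<le> B * norm h"
      using assms(3)[OF that] by (simp add: mult_right_mono)
    finally show "norm (G x \<bullet> h) \<le> B * norm h"
      by simp
  qed
  then show ?thesis
    using differentiable_bound[OF assms(1,2) _ assms(4,5)] by simp
qed

section \<open>Mixed second derivatives in weak form\<close>

lemma integrable_continuous_compact_support:
  fixes f :: "'a::euclidean_space \<Rightarrow> real"
  assumes "compact K" "continuous_on K f" "\<And>x. x \<notin> K \<Longrightarrow> f x = 0"
  shows "integrable lborel f"
proof -
  have "(\<lambda>x. indicator K x *\<^sub>R f x) = f"
    using assms(3) by (auto simp: indicator_def fun_eq_iff)
  then show ?thesis
    using borel_integrable_compact[OF assms(1,2)] by simp
qed

lemma lborel_integral_shift: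
  fixes f :: "'a::euclidean_space \<Rightarrow> real"
  assumes "f \<in> borel_measurable borel"
  shows "(\<integral>x. f (c + x) \<partial>lborel) = (\<integral>x. f x \<partial>lborel)"
proof -
  have "(\<integral>x. f x \<partial>lborel) = (\<integral>x. f x \<partial>distr lborel borel ((+) c))"
    by (simp add: lborel_distr_plus)
  also have "\<dots> = (\<integral>x. f (c + x) \<partial>lborel)"
    by (rule integral_distr) (use assms in auto)
  finally show ?thesis by simp
qed

lemma difference_quotient_LIMSEQ:
  fixes g :: "'a::euclidean_space \<Rightarrow> real"
  assumes "(g has_derivative (\<lambda>h. D \<bullet> h)) (at x)"
  shows "(\<lambda>m. (g (x + (1 / real (Suc m)) *\<^sub>R a) - g x) / (1 / real (Suc m))) \<longlonglongrightarrow> D \<bullet> a"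
proof -
  have "((\<lambda>t. g (x + t *\<^sub>R a)) has_derivative (\<lambda>t. D \<bullet> (t *\<^sub>R a))) (at 0)"
    by (rule has_derivative_compose[of "\<lambda>t. x + t *\<^sub>R a" "\<lambda>t. t *\<^sub>R a" 0 UNIV g "\<lambda>h. D \<bullet> h"])
      (use assms in \<open>auto intro!: derivative_eq_intros\<close>)
  then have "((\<lambda>t. g (x + t *\<^sub>R a)) has_field_derivative (D \<bullet> a)) (at 0)"
    by (simp add: has_field_derivative_def mult_commute_abs)
  then have "((\<lambda>t. (g (x + t *\<^sub>R a) - g x) / t) \<longlongrightarrow> D \<bullet> a) (at 0)"
    by (simp add: has_field_derivative_iff)
  moreover have "filterlim (\<lambda>m. 1 / real (Suc m)) (at 0) sequentially"
    unfolding filterlim_at using LIMSEQ_inverse_real_of_nat by (simp add: inverse_eq_divide)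
  ultimately show ?thesis
    by (rule filterlim_compose)
qed

lemma lipschitz_bound_imp_continuous:
  fixes g :: "'a::real_normed_vector \<Rightarrow> real"
  assumes "\<And>x y. \<bar>g x - g y\<bar> \<le> L * norm (x - y)"
  shows "continuous_on UNIV g"
proof (rule lipschitz_on_continuous_on, rule lipschitz_onI)
  show "dist (g x) (g y) \<le> \<bar>L\<bar> * dist x y" for x y
  proof -
    have "\<bar>g x - g y\<bar> \<le> L * norm (x - y)"
      by (rule assms)
    also have "\<dots> \<le> \<bar>L\<bar> * norm (x - y)"
      by (rule mult_right_mono) auto
    finally show ?thesis
      by (simp add: dist_norm)
  qed
qed simp

text \<open>Symmetry of mixed second derivatives in weak form, for functions that are only
  Lipschitz and once differentiable: for difference quotients the identity is exact by
  translation invariance, and it passes to the limit by dominated convergence.\<close>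

lemma integral_gradient_product_swap:
  fixes g \<psi> :: "'a::euclidean_space \<Rightarrow> real" and G \<Psi> :: "'a \<Rightarrow> 'a"
  assumes lip_g: "\<And>x y. \<bar>g x - g y\<bar> \<le> L * norm (x - y)"
    and lip_\<psi>: "\<And>x y. \<bar>\<psi> x - \<psi> y\<bar> \<le> M * norm (x - y)"
    and K: "compact K" "\<And>x. x \<notin> K \<Longrightarrow> \<psi> x = 0" "\<And>x. x \<notin> K \<Longrightarrow> \<Psi> x = 0"
    and G: "\<And>x. x \<in> K \<Longrightarrow> (g has_derivative (\<lambda>h. G x \<bullet> h)) (at x)"
    and \<Psi>: "\<And>x. (\<psi> has_derivative (\<lambda>h. \<Psi> x \<bullet> h)) (at x)"
  shows "(\<integral>x. (G x \<bullet> a) * (\<Psi> x \<bullet> b) \<partial>lborel) = (\<integral>x. (G x \<bullet> b) * (\<Psi> x \<bullet> a) \<partial>lborel)"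
proof -
  have cont_g: "continuous_on UNIV g" and cont_\<psi>: "continuous_on UNIV \<psi>"
    by (rule lipschitz_bound_imp_continuous[OF lip_g], rule lipschitz_bound_imp_continuous[OF lip_\<psi>])
  have int: "integrable lborel (\<lambda>x. g (u + x) * \<psi> (w + x))" for u w
  proof (rule integrable_continuous_compact_support)
    show "compact ((+) (- w) ` K)"
      using K(1) by (rule compact_translation)
    show "continuous_on ((+) (- w) ` K) (\<lambda>x. g (u + x) * \<psi> (w + x))"
      by (intro continuous_intros continuous_on_compose2[OF cont_g] continuous_on_compose2[OF cont_\<psi>]) auto
    fix x assume "x \<notin> (+) (- w) ` K"
    then have "w + x \<notin> K"
      by (force simp: image_iff)
    then show "g (u + x) * \<psi> (w + x) = 0"
      using K(2) by simp
  qed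
  \<comment> \<open>By translation invariance, the integral of g against \<psi> with both shifted
    depends only on the difference of the shifts.\<close>
  define J where "J u = (\<integral>x. g (u + x) * \<psi> x \<partial>lborel)" for u
  have J: "(\<integral>x. g (u + x) * \<psi> (w + x) \<partial>lborel) = J (u - w)" for u w
  proof -
    have "(\<lambda>x. g (u - w + x) * \<psi> x) \<in> borel_measurable borel"
      using borel_measurable_integrable[OF int[of "u - w" 0]] by simp
    from lborel_integral_shift[OF this, of w] show ?thesis
      by (simp add: J_def algebra_simps)
  qed
  define h where "h m = 1 / real (Suc m)" for m
  have h_pos: "0 < h m" "h m \<le> 1" for m
    by (simp_all add: h_def)
  \<comment> \<open>With g shifted along a and \<psi> along -b the shifts add up in the product: its
    integral involves J only at h a + h b, h a, h b and 0, which is symmetric in a and b. The sign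
    of -b reappears in the limit.\<close>
  define A where "A a b m x = ((g (x + h m *\<^sub>R a) - g x) / h m) * ((\<psi> (x + h m *\<^sub>R (- b)) - \<psi> x) / h m)" for a b m x
  have A_eq: "A a b m = (\<lambda>x. (g (h m *\<^sub>R a + x) * \<psi> (- (h m *\<^sub>R b) + x) - g (h m *\<^sub>R a + x) * \<psi> (0 + x)
      - (g (0 + x) * \<psi> (- (h m *\<^sub>R b) + x) - g (0 + x) * \<psi> (0 + x))) / (h m * h m))" for a b m
    using h_pos(1)[of m] by (simp add: A_def fun_eq_iff field_simps)
  have A_int: "integral\<^sup>L lborel (A a b m) = (J (h m *\<^sub>R a + h m *\<^sub>R b) - J (h m *\<^sub>R a) - (J (h m *\<^sub>R b) - J 0)) / (h m * h m)" for a b m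
    unfolding A_eq by (simp only: integral_divide_zero Bochner_Integration.integral_diff Bochner_Integration.integrable_diff int J) simp
  have A_swap: "integral\<^sup>L lborel (A a b m) = integral\<^sup>L lborel (A b a m)" for a b m
    unfolding A_int by (simp add: add.commute)
  have A_lim: "(\<lambda>m. A a b m x) \<longlonglongrightarrow> - ((G x \<bullet> a) * (\<Psi> x \<bullet> b))" for a b x
  proof -
    have psi: "(\<lambda>m. (\<psi> (x + h m *\<^sub>R (- b)) - \<psi> x) / h m) \<longlonglongrightarrow> - (\<Psi> x \<bullet> b)"
      using difference_quotient_LIMSEQ[OF \<Psi>, of x "- b"] by (simp add: h_def)
    show ?thesis
    proof (cases "x \<in> K")
      case True
      from tendsto_mult[OF difference_quotient_LIMSEQ[OF G[OF True], of a] psi[unfolded h_def]]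
      show ?thesis
        unfolding A_def h_def by simp
    next
      \<comment> \<open>Off K the function g need not be differentiable, but its quotients stay
        bounded while those of \<psi> tend to 0.\<close>
      case False
      have "norm ((g (x + h m *\<^sub>R a) - g x) / h m) \<le> L * norm a" for m
      proof -
        have "\<bar>g (x + h m *\<^sub>R a) - g x\<bar> \<le> L * norm a * h m"
          using lip_g[of "x + h m *\<^sub>R a" x] h_pos(1)[of m] by (simp add: mult_ac)
        then show ?thesis
          using h_pos(1)[of m] by (simp add: divide_le_eq)
      qed
      moreover have "(\<lambda>m. (\<psi> (x + h m *\<^sub>R (- b)) - \<psi> x) / h m) \<longlonglongrightarrow> 0"
        using psi K(3)[OF False] by simp
      ultimately have "(\<lambda>m. A a b m x) \<longlonglongrightarrow> 0"
        unfolding A_def by (intro lim_null_mult_left_bounded[where B = "L * norm a"]) auto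
      then show ?thesis
        using K(3)[OF False] by simp
    qed
  qed
  have A_meas: "A a b m \<in> borel_measurable lborel" for a b m
    unfolding A_eq by (intro borel_measurable_divide borel_measurable_diff borel_measurable_const borel_measurable_integrable[OF int])
  obtain r where r: "\<And>x. x \<in> K \<Longrightarrow> norm x \<le> r"
    using compact_imp_bounded[OF K(1)] unfolding bounded_iff by blast
  \<comment> \<open>The product vanishes unless x or its shift by at most \<open>norm b\<close> lies
    in K. This gives an integrable majorant independent of m.\<close>
  have A_bound: "norm (A a b m x) \<le> (L * norm a) * (M * norm b) * indicator (cball 0 (r + norm b)) x" for a b m x
  proof (cases "x \<in> cball 0 (r + norm b)")
    case False
    then have x: "norm x > r + norm b"
      by simp
    have "x \<notin> K"
      using r[of x] x norm_ge_zero[of b] by linarith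
    moreover have "x + h m *\<^sub>R (- b) \<notin> K"
    proof
      assume *: "x + h m *\<^sub>R (- b) \<in> K"
      have "norm x \<le> norm (x + h m *\<^sub>R (- b)) + norm (h m *\<^sub>R b)"
        using norm_triangle_ineq[of "x + h m *\<^sub>R (- b)" "h m *\<^sub>R b"] by simp
      also have "norm (h m *\<^sub>R b) \<le> norm b"
        using h_pos[of m] by (simp add: mult_left_le_one_le)
      finally show False
        using r[OF *] x by simp
    qed
    ultimately show ?thesis
      using K(2) False by (simp add: A_def)
  next
    case True
    have 1: "\<bar>(g (x + h m *\<^sub>R a) - g x) / h m\<bar> \<le> L * norm a"
      using lip_g[of "x + h m *\<^sub>R a" x] h_pos(1)[of m] by (simp add: divide_le_eq mult_ac)
    have 2: "\<bar>(\<psi> (x + h m *\<^sub>R (- b)) - \<psi> x) / h m\<bar> \<le> M * norm b"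
      using lip_\<psi>[of "x + h m *\<^sub>R (- b)" x] h_pos(1)[of m] by (simp add: divide_le_eq mult_ac)
    have "\<bar>A a b m x\<bar> \<le> (L * norm a) * (M * norm b)"
      unfolding A_def abs_mult by (rule mult_mono[OF 1 2]) (use 1 in linarith, simp)
    then show ?thesis
      using True by simp
  qed
  have lim: "(\<lambda>m. integral\<^sup>L lborel (A a b m)) \<longlonglongrightarrow> (\<integral>x. - ((G x \<bullet> a) * (\<Psi> x \<bullet> b)) \<partial>lborel)" for a b
  proof (rule integral_dominated_convergence)
    show "(\<lambda>x. - ((G x \<bullet> a) * (\<Psi> x \<bullet> b))) \<in> borel_measurable lborel"
      by (rule borel_measurable_LIMSEQ_real[OF A_lim A_meas])
    show "integrable lborel (\<lambda>x. (L * norm a) * (M * norm b) * indicator (cball 0 (r + norm b)) x :: real)"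
      by (intro integrable_mult_right integrable_real_indicator) (use emeasure_lborel_cball_finite in \<open>auto simp: less_top\<close>)
  qed (use A_meas A_lim A_bound in auto)
  have "(\<integral>x. - ((G x \<bullet> a) * (\<Psi> x \<bullet> b)) \<partial>lborel) = (\<integral>x. - ((G x \<bullet> b) * (\<Psi> x \<bullet> a)) \<partial>lborel)"
    using LIMSEQ_unique[OF lim[of a b]] lim[of b a] A_swap[of a b] by simp
  then show ?thesis by simp
qed

section \<open>Weak curls\<close>

lemma vector_3_eq: "vector [a, b, c] = a *\<^sub>R axis 1 1 + b *\<^sub>R axis 2 1 + c *\<^sub>R (axis 3 1 :: real^3)"
  by (simp add: vec_eq_iff forall_3 axis_def)

lemma test_fieldE:
  assumes "test_field T \<phi>"
  obtains K where "compact K" "K \<subseteq> interior T" "\<And>x. x \<notin> K \<Longrightarrow> \<phi> x = 0"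
    "\<And>x k. x \<notin> K \<Longrightarrow> grad UNIV (\<lambda>y. \<phi> y $ k) x = 0"
proof -
  obtain K where K: "compact K" "K \<subseteq> interior T" "\<And>x. x \<notin> K \<Longrightarrow> \<phi> x = 0"
    using assms unfolding test_field_def by blast
  have "grad UNIV (\<lambda>y. \<phi> y $ k) x = 0" if "x \<notin> K" for x k
  proof (rule grad_eqI)
    have "((\<lambda>y. 0::real) has_derivative (\<lambda>h. 0 \<bullet> h)) (at x)"
      by simp
    then show "((\<lambda>y. \<phi> y $ k) has_derivative (\<lambda>h. 0 \<bullet> h)) (at x)"
      by (rule has_derivative_transform_within_open[where s = "- K"])
        (use K that compact_imp_closed in auto)
  qed auto
  then show ?thesis
    using that K by blast
qed

lemma test_field_grad:
  assumes "test_field T \<phi>"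
  shows "((\<lambda>y. \<phi> y $ k) has_derivative (\<lambda>h. grad UNIV (\<lambda>y. \<phi> y $ k) x \<bullet> h)) (at x)"
    and "continuous_on UNIV (grad UNIV (\<lambda>y. \<phi> y $ k))"
    and "continuous_on UNIV (\<lambda>y. \<phi> y $ k)"
proof -
  have "C1_on UNIV (\<lambda>y. \<phi> y $ k)"
    using assms unfolding test_field_def by blast
  then show "((\<lambda>y. \<phi> y $ k) has_derivative (\<lambda>h. grad UNIV (\<lambda>y. \<phi> y $ k) x \<bullet> h)) (at x)"
    and "continuous_on UNIV (grad UNIV (\<lambda>y. \<phi> y $ k))"
    and "continuous_on UNIV (\<lambda>y. \<phi> y $ k)"
    using C1_on_grad[of UNIV "\<lambda>y. \<phi> y $ k"] C1_on_imp_continuous_on by auto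
qed

lemma continuous_on_curl:
  assumes "test_field T \<phi>"
  shows "continuous_on S (curl \<phi>)"
proof -
  have "continuous_on UNIV (\<lambda>x. curl \<phi> x)"
    unfolding curl_def Let_def vector_3_eq
    by (intro continuous_intros test_field_grad(2)[OF assms])
  then show ?thesis
    using continuous_on_subset by auto
qed

lemma curl_eq_0:
  assumes "\<And>k. grad UNIV (\<lambda>y. \<phi> y $ k) x = 0"
  shows "curl \<phi> x = 0"
  by (simp add: curl_def vector_3_eq assms)

lemma integral_eq_lborel:
  fixes F :: "'a::euclidean_space \<Rightarrow> real"
  assumes "compact K" "K \<subseteq> T" "continuous_on K F" "\<And>x. x \<notin> K \<Longrightarrow> F x = 0"
  shows "integral T F = (\<integral>x. F x \<partial>lborel)"
proof -
  have "integrable lborel F"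
    by (rule integrable_continuous_compact_support[OF assms(1,3,4)])
  then have "integral UNIV F = (\<integral>x. F x \<partial>lborel)"
    by (rule integral_lborel)
  moreover have "(\<lambda>x. if x \<in> T then F x else 0) = F"
    using assms(2,4) by force
  ultimately show ?thesis
    using integral_restrict_UNIV[of T F] by simp
qed

lemma integrable_on_compact:
  fixes F :: "'a::euclidean_space \<Rightarrow> real"
  assumes "compact T" "continuous_on T F"
  shows "F integrable_on T"
proof -
  have "(\<lambda>x. indicator T x *\<^sub>R F x) integrable_on UNIV"
    by (rule integrable_on_lborel[OF borel_integrable_compact[OF assms]])
  moreover have "(\<lambda>x. indicator T x *\<^sub>R F x) = (\<lambda>x. if x \<in> T then F x else 0)"
    by (auto simp: indicator_def)
  ultimately show ?thesis
    by (simp add: integrable_restrict_UNIV)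
qed

text \<open>Nearest-point projection onto a closed convex set does not increase distances, so
  composing with it extends g to a Lipschitz function on the whole space.\<close>

lemma C1_on_lipschitz:
  assumes T: "convex T" "compact T" "interior T \<noteq> {}" and g: "C1_on T g"
  obtains L where "\<And>x y. \<bar>g (closest_point T x) - g (closest_point T y)\<bar> \<le> L * norm (x - y)"
proof -
  have "T \<noteq> {}" "closed T"
    using T interior_subset compact_imp_closed by auto
  note G = C1_on_grad[OF T(1,3) g]
  have "bounded (grad T g ` T)"
    using compact_continuous_image[OF G(2) T(2)] compact_imp_bounded by blast
  then obtain L where L: "0 < L" "\<And>x. x \<in> T \<Longrightarrow> norm (grad T g x) \<le> L"
    unfolding bounded_pos by auto
  have "\<bar>g (closest_point T x) - g (closest_point T y)\<bar> \<le> L * norm (x - y)" for x y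
  proof -
    have "closest_point T z \<in> T" for z
      using closest_point_in_set[OF \<open>closed T\<close> \<open>T \<noteq> {}\<close>] .
    then have "\<bar>g (closest_point T x) - g (closest_point T y)\<bar> \<le> L * norm (closest_point T x - closest_point T y)"
      using gradient_bound_imp_lipschitz[OF T(1) G(1) L(2)] by blast
    also have "\<dots> \<le> L * norm (x - y)"
      using closest_point_lipschitz[OF T(1) \<open>closed T\<close> \<open>T \<noteq> {}\<close>, of x y] L(1)
      by (simp add: dist_norm)
    finally show ?thesis .
  qed
  then show ?thesis
    using that by blast
qed

lemma interior_has_derivative:
  assumes T: "convex T" "interior T \<noteq> {}" "C1_on T g" and x: "x \<in> interior T"
  shows "(g has_derivative (\<lambda>h. grad T g x \<bullet> h)) (at x)"
  using C1_on_grad(1)[OF T, of x] x interior_subset at_within_interior[OF x] by auto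

text \<open>The integrands differ by grad g . curl (f \<phi>). So the claim is that a gradient is
  weakly orthogonal to the curl of a compactly supported field, which is the weak symmetry of mixed
  derivatives for g and each component of f \<phi>.\<close>

lemma weak_curl_scaled_gradient:
  assumes T: "convex T" "compact T" "interior T \<noteq> {}" and f: "C1_on T f" and g: "C1_on T g"
    and test: "test_field T \<phi>"
  shows "integral T (\<lambda>x. (f x *\<^sub>R grad T g x) \<bullet> curl \<phi> x) =
    integral T (\<lambda>x. cross3 (grad T f x) (grad T g x) \<bullet> \<phi> x)"
proof -
  obtain K where K: "compact K" "K \<subseteq> interior T" "\<And>x. x \<notin> K \<Longrightarrow> \<phi> x = 0"
    "\<And>x k. x \<notin> K \<Longrightarrow> grad UNIV (\<lambda>y. \<phi> y $ k) x = 0"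
    using test_fieldE[OF test] by blast
  have KT: "K \<subseteq> T"
    using K(2) interior_subset by blast
  define P where "P k = grad UNIV (\<lambda>y. \<phi> y $ k)" for k
  note P = test_field_grad[OF test, folded P_def]
  have P0: "P k x = 0" if "x \<notin> K" for k x
    using K(4)[OF that] by (simp add: P_def)
  note Gf = C1_on_grad[OF T(1,3) f] and Gg = C1_on_grad[OF T(1,3) g]
  have cont: "continuous_on K f" "continuous_on K (grad T f)" "continuous_on K (grad T g)"
    "continuous_on K (P k)" "continuous_on K (\<lambda>x. \<phi> x $ k)" for k
    using continuous_on_subset KT C1_on_imp_continuous_on[OF f] Gf(2) Gg(2) P(2,3)[of k] by blast+
  have self: "closest_point T x = x" if "x \<in> interior T" for x
    using that interior_subset by (intro closest_point_self) blast
  \<comment> \<open>The components of f \<phi> on the whole space, followed by their gradients; both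
    vanish off K, where only \<phi> matters.\<close>
  define \<psi> where "\<psi> k x = f (closest_point T x) * \<phi> x $ k" for k x
  define \<Psi> where "\<Psi> k x = (if x \<in> K then f x *\<^sub>R P k x + \<phi> x $ k *\<^sub>R grad T f x else 0)" for k x
  have deriv: "(\<psi> k has_derivative (\<lambda>h. \<Psi> k x \<bullet> h)) (at x)" for k x
  proof (cases "x \<in> K")
    case True
    then have x: "x \<in> interior T"
      using K(2) by blast
    have "((\<lambda>x. f x * \<phi> x $ k) has_derivative (\<lambda>h. f x * (P k x \<bullet> h) + (grad T f x \<bullet> h) * \<phi> x $ k)) (at x)"
      by (rule has_derivative_mult[OF interior_has_derivative[OF T(1,3) f x] P(1)])
    then have "((\<lambda>x. f x * \<phi> x $ k) has_derivative (\<lambda>h. \<Psi> k x \<bullet> h)) (at x)"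
      using True by (simp add: \<Psi>_def inner_add_left mult.commute)
    then show ?thesis
      by (rule has_derivative_transform_within_open[where s = "interior T"])
        (use x self in \<open>auto simp: \<psi>_def\<close>)
  next
    case False
    have "((\<lambda>x. 0) has_derivative (\<lambda>h. \<Psi> k x \<bullet> h)) (at x)"
      using False by (simp add: \<Psi>_def)
    then show ?thesis
      by (rule has_derivative_transform_within_open[where s = "- K"])
        (use False K(1,3) compact_imp_closed in \<open>auto simp: \<psi>_def\<close>)
  qed
  have \<Psi>_cont: "continuous_on K (\<Psi> k)" for k
  proof -
    have "continuous_on K (\<lambda>x. f x *\<^sub>R P k x + \<phi> x $ k *\<^sub>R grad T f x)"
      by (intro continuous_intros cont)
    then show ?thesis
      by (rule continuous_on_eq) (simp add: \<Psi>_def)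
  qed
  obtain L where L: "\<And>x y. \<bar>g (closest_point T x) - g (closest_point T y)\<bar> \<le> L * norm (x - y)"
    using C1_on_lipschitz[OF T g] by blast
  have \<psi>_lip: "\<exists>M. \<forall>x y. \<bar>\<psi> k x - \<psi> k y\<bar> \<le> M * norm (x - y)" for k
  proof -
    have "bounded (\<Psi> k ` K)"
      using compact_continuous_image[OF \<Psi>_cont K(1)] compact_imp_bounded by blast
    then obtain M where M: "0 < M" "\<And>x. x \<in> K \<Longrightarrow> norm (\<Psi> k x) \<le> M"
      unfolding bounded_pos by auto
    have "norm (\<Psi> k x) \<le> M" for x
      using M by (cases "x \<in> K") (auto simp: \<Psi>_def)
    then have "\<bar>\<psi> k x - \<psi> k y\<bar> \<le> M * norm (x - y)" for x y
      using gradient_bound_imp_lipschitz[of UNIV "\<psi> k" "\<Psi> k" M] deriv by simp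
    then show ?thesis by blast
  qed
  have swap: "(\<integral>x. (grad T g x \<bullet> a) * (\<Psi> k x \<bullet> b) \<partial>lborel) = (\<integral>x. (grad T g x \<bullet> b) * (\<Psi> k x \<bullet> a) \<partial>lborel)" for a b k
  proof -
    obtain M where M: "\<And>x y. \<bar>\<psi> k x - \<psi> k y\<bar> \<le> M * norm (x - y)"
      using \<psi>_lip by blast
    show ?thesis
    proof (rule integral_gradient_product_swap[OF L M K(1)])
      show "((\<lambda>x. g (closest_point T x)) has_derivative (\<lambda>h. grad T g x \<bullet> h)) (at x)" if "x \<in> K" for x
      proof (rule has_derivative_transform_within_open[where s = "interior T"])
        show "(g has_derivative (\<lambda>h. grad T g x \<bullet> h)) (at x)"
          using interior_has_derivative[OF T(1,3) g] that K(2) by blast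
      qed (use that K(2) self in auto)
      show "(\<psi> k has_derivative (\<lambda>h. \<Psi> k x \<bullet> h)) (at x)" for x
        by (rule deriv)
    qed (simp_all add: \<psi>_def \<Psi>_def K(3))
  qed
  define Q where "Q k a b x = (grad T g x \<bullet> axis a 1) * (\<Psi> k x \<bullet> axis b 1)" for k a b x
  have Q_int: "integrable lborel (Q k a b)" for k a b
  proof (rule integrable_continuous_compact_support[OF K(1)])
    show "continuous_on K (Q k a b)"
      unfolding Q_def by (intro continuous_intros cont \<Psi>_cont)
  qed (simp add: Q_def \<Psi>_def)
  have Q_swap: "integral\<^sup>L lborel (Q k a b) = integral\<^sup>L lborel (Q k b a)" for k a b
    unfolding Q_def by (rule swap)
  \<comment> \<open>The six terms of grad g . curl (f \<phi>), grouped by the component of f \<phi>,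
    so that \<open>Q_swap\<close> cancels each pair after integration.\<close>
  have point: "(f x *\<^sub>R grad T g x) \<bullet> curl \<phi> x - cross3 (grad T f x) (grad T g x) \<bullet> \<phi> x =
     Q 3 1 2 x - Q 3 2 1 x + (Q 1 2 3 x - Q 1 3 2 x) + (Q 2 3 1 x - Q 2 1 3 x)" for x
  proof (cases "x \<in> K")
    case True
    then have "Q k a b x = grad T g x $ a * (f x * P k x $ b + \<phi> x $ k * grad T f x $ b)" for k a b
      by (simp add: Q_def \<Psi>_def inner_axis)
    then show ?thesis
      by (simp add: curl_def P_def[symmetric] Let_def inner_vec_def sum_3 cross_components vector_3 algebra_simps)
  next
    case False
    then show ?thesis
      using K(3) curl_eq_0[of \<phi> x] K(4) by (simp add: Q_def \<Psi>_def)
  qed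
  let ?F1 = "\<lambda>x. (f x *\<^sub>R grad T g x) \<bullet> curl \<phi> x"
  let ?F2 = "\<lambda>x. cross3 (grad T f x) (grad T g x) \<bullet> \<phi> x"
  have cont_\<phi>: "continuous_on K \<phi>"
    using continuous_on_vec_lambda[of K "\<lambda>k x. \<phi> x $ k"] cont(5) by simp
  have F1: "continuous_on K ?F1" "\<And>x. x \<notin> K \<Longrightarrow> ?F1 x = 0"
    using curl_eq_0[of \<phi>] K(4) by (auto intro!: continuous_intros cont continuous_on_curl[OF test])
  have F2: "continuous_on K ?F2" "\<And>x. x \<notin> K \<Longrightarrow> ?F2 x = 0"
    using K(3) by (auto intro!: continuous_intros cont cont_\<phi> continuous_on_cross)
  have "integral T ?F1 - integral T ?F2 = (\<integral>x. ?F1 x \<partial>lborel) - (\<integral>x. ?F2 x \<partial>lborel)"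
    using integral_eq_lborel[OF K(1) KT] F1 F2 by simp
  also have "\<dots> = (\<integral>x. ?F1 x - ?F2 x \<partial>lborel)"
    using integrable_continuous_compact_support[OF K(1)] F1 F2 by (intro Bochner_Integration.integral_diff[symmetric]) auto
  also have "\<dots> = 0"
    unfolding point
    by (simp add: Bochner_Integration.integral_add Bochner_Integration.integral_diff Q_int
        Q_swap[of 3 1 2] Q_swap[of 1 2 3] Q_swap[of 2 3 1])
  finally show ?thesis by simp
qed

text \<open>Continuity of u guarantees that its integrals against curls of test fields exist, so
  that weak curls can be added; an integral in \<open>has_curl\<close> alone could be the default
  value 0.\<close>

definition cont_curl :: "(real^3) set \<Rightarrow> field \<Rightarrow> field \<Rightarrow> bool" where
  "cont_curl T u w \<longleftrightarrow> continuous_on T u \<and> has_curl T u w"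

lemma cont_curl_integrable:
  assumes "compact T" "continuous_on T u" "test_field T \<phi>"
  shows "(\<lambda>x. u x \<bullet> curl \<phi> x) integrable_on T" "(\<lambda>x. u x \<bullet> \<phi> x) integrable_on T"
proof -
  have "continuous_on T \<phi>"
    using continuous_on_vec_lambda[of T "\<lambda>k x. \<phi> x $ k"] test_field_grad(3)[OF assms(3)]
      continuous_on_subset by (metis (no_types, lifting) subset_UNIV vec_nth_inverse continuous_on_cong)
  then show "(\<lambda>x. u x \<bullet> curl \<phi> x) integrable_on T" "(\<lambda>x. u x \<bullet> \<phi> x) integrable_on T"
    using assms by (auto intro!: integrable_on_compact continuous_intros continuous_on_curl)
qed

lemma cont_curl_add:
  assumes T: "compact T" and "cont_curl T u w" "cont_curl T u' w'"
  shows "cont_curl T (\<lambda>x. u x + u' x) (\<lambda>x. w x + w' x)"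
  using assms unfolding cont_curl_def has_curl_def
  by (auto intro!: continuous_intros simp: inner_add_left Henstock_Kurzweil_Integration.integral_add cont_curl_integrable)

lemma cont_curl_scaleR:
  assumes "cont_curl T u w"
  shows "cont_curl T (\<lambda>x. c *\<^sub>R u x) (\<lambda>x. c *\<^sub>R w x)"
  using assms unfolding cont_curl_def has_curl_def by (auto intro!: continuous_intros)

lemma cont_curl_diff:
  assumes "compact T" "cont_curl T u w" "cont_curl T u' w'"
  shows "cont_curl T (\<lambda>x. u x - u' x) (\<lambda>x. w x - w' x)"
  using cont_curl_add[OF assms(1,2) cont_curl_scaleR[OF assms(3), of "-1"]] by simp

lemma cont_curl_sum:
  assumes "compact T" "\<And>i. i \<in> A \<Longrightarrow> cont_curl T (u i) (w i)"
  shows "cont_curl T (\<lambda>x. \<Sum>i\<in>A. u i x) (\<lambda>x. \<Sum>i\<in>A. w i x)"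
proof -
  have zero: "cont_curl T (\<lambda>x. 0) (\<lambda>x. 0)"
    by (simp add: cont_curl_def has_curl_def)
  show ?thesis
    using assms(2)
    by (induction A rule: infinite_finite_induct) (auto simp: zero intro!: cont_curl_add[OF assms(1)])
qed

text \<open>The weak curl of f grad g is grad f x grad g; the subtracted term yields the same
  product in the opposite order, hence the factor 2.\<close>

lemma cont_curl_whitney:
  assumes T: "convex T" "compact T" "interior T \<noteq> {}" and "C1_on T (lam i)" "C1_on T (lam j)"
  shows "cont_curl T (whitney T lam i j) (\<lambda>x. 2 *\<^sub>R cross3 (grad T (lam i) x) (grad T (lam j) x))"
proof -
  have scaled: "cont_curl T (\<lambda>x. lam i x *\<^sub>R grad T (lam j) x) (\<lambda>x. cross3 (grad T (lam i) x) (grad T (lam j) x))"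
    if "C1_on T (lam i)" "C1_on T (lam j)" for i j
    unfolding cont_curl_def has_curl_def
    using weak_curl_scaled_gradient[OF T that] C1_on_grad(2)[OF T(1,3)] that C1_on_imp_continuous_on
    by (auto intro!: continuous_intros continuous_on_cross)
  have "cross3 (grad T (lam i) x) (grad T (lam j) x) - cross3 (grad T (lam j) x) (grad T (lam i) x) =
      2 *\<^sub>R cross3 (grad T (lam i) x) (grad T (lam j) x)" for x
    using cross_skew[of "grad T (lam j) x"] by (simp add: scaleR_2)
  then show ?thesis
    using cont_curl_diff[OF T(2) scaled[OF assms(4,5)] scaled[OF assms(5,4)]]
    unfolding whitney_def by simp
qed

section \<open>The two inclusions\<close>

lemma span_combination:
  assumes "\<And>i. i \<in> A \<Longrightarrow> b i \<in> S"
  shows "(\<lambda>x. \<Sum>i\<in>A. c i *\<^sub>R b i x) \<in> fields.span S"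
proof -
  have "(\<lambda>x. \<Sum>i\<in>A. c i *\<^sub>R b i x) = (\<Sum>i\<in>A. (\<lambda>x. c i *\<^sub>R b i x))"
    by (induction A rule: infinite_finite_induct) (simp_all add: fun_eq_iff)
  moreover have "\<dots> \<in> fields.span S"
    using assms by (intro fields.span_sum fields.span_scale fields.span_base)
  ultimately show ?thesis
    by simp
qed

text \<open>Differentiate the reproduction of the affine function q . x + b and use uniqueness of
  relative gradients. For q = 0 and b = 1 it says that the gradients sum to zero.\<close>

lemma gbc_gradients:
  assumes T: "convex T" "interior T \<noteq> {}" and gbc: "gbc T I v lam"
    and C1: "\<And>i. i \<in> I \<Longrightarrow> C1_on T (lam i)" and x: "x \<in> T"
  shows "(\<Sum>i\<in>I. (q \<bullet> v i + b) *\<^sub>R grad T (lam i) x) = q"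
proof (rule gradient_within_unique[OF T x])
  have "((\<lambda>x. \<Sum>i\<in>I. (q \<bullet> v i + b) * lam i x) has_derivative
      (\<lambda>h. \<Sum>i\<in>I. (q \<bullet> v i + b) * (grad T (lam i) x \<bullet> h))) (at x within T)"
    by (intro has_derivative_sum has_derivative_mult_right C1_on_grad(1)[OF T C1 x])
  then show "((\<lambda>x. \<Sum>i\<in>I. (q \<bullet> v i + b) * lam i x) has_derivative
      (\<lambda>h. (\<Sum>i\<in>I. (q \<bullet> v i + b) *\<^sub>R grad T (lam i) x) \<bullet> h)) (at x within T)"
    by (simp add: inner_sum_left)
  have "((\<lambda>x. q \<bullet> x + b) has_derivative (\<lambda>h. q \<bullet> h)) (at x within T)"
    by (auto intro!: derivative_eq_intros)
  then show "((\<lambda>x. \<Sum>i\<in>I. (q \<bullet> v i + b) * lam i x) has_derivative (\<lambda>h. q \<bullet> h)) (at x within T)"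
    by (rule has_derivative_transform[OF x, rotated]) (use gbc in \<open>simp add: gbc_def\<close>)
qed

lemma whitney_face_eq_combine:
  "whitney_face T n v lam C f x =
    (\<Sum>(i, j)\<in>face_bdry T n v f. combine T n v C (\<lambda>i j. whitney T lam i j x) i j)"
  by (simp add: whitney_face_def whitney_edge_def combine_def)

context tri_par_polyhedron
begin

text \<open>\<open>combine\<close> is linear in its array with coefficients independent of x, so the
  weak curl passes through it.\<close>

lemma cont_curl_combine:
  assumes W: "\<And>i j. i \<in> {1..n} \<Longrightarrow> j \<in> {1..n} \<Longrightarrow> cont_curl T (W i j) (K i j)"
    and ij: "i \<in> {1..n}" "j \<in> {1..n}"
  shows "cont_curl T (\<lambda>x. combine T n v C (\<lambda>i j. W i j x) i j) (\<lambda>x. combine T n v C (\<lambda>i j. K i j x) i j)"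
proof -
  have "(k, l) \<in> face_diagonals T n v \<Longrightarrow> l \<in> {1..n}" "(k, l) \<in> inner_diagonals T n v \<Longrightarrow> l \<in> {1..n}" for k l
    by (auto simp: face_diagonals_def inner_diagonals_def segments_def)
  then show ?thesis
    unfolding combine_def
    using ij by (intro cont_curl_add[OF compact] cont_curl_diff[OF compact] cont_curl_scaleR cont_curl_sum[OF compact] W) auto
qed

lemma has_curl_whitney_face:
  assumes C1: "\<And>i. i \<in> {1..n} \<Longrightarrow> C1_on T (lam i)"
  shows "has_curl T (whitney_face T n v lam C f)
    (\<lambda>x. \<Sum>(i, j)\<in>face_bdry T n v f.
       combine T n v C (\<lambda>i j. 2 *\<^sub>R cross3 (grad T (lam i) x) (grad T (lam j) x)) i j)"
proof -
  have "cont_curl T (\<lambda>x. \<Sum>e\<in>face_bdry T n v f. combine T n v C (\<lambda>i j. whitney T lam i j x) (fst e) (snd e))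
    (\<lambda>x. \<Sum>e\<in>face_bdry T n v f.
       combine T n v C (\<lambda>i j. 2 *\<^sub>R cross3 (grad T (lam i) x) (grad T (lam j) x)) (fst e) (snd e))"
  proof (intro cont_curl_sum[OF compact] cont_curl_combine cont_curl_whitney convex compact interior_ne C1)
    fix e assume "e \<in> face_bdry T n v f"
    then have "(fst e, snd e) \<in> edges T n v"
      using face_bdry_edge[of "fst e" "snd e" f] by simp
    then show "fst e \<in> {1..n}" "snd e \<in> {1..n}"
      by (rule edgeD)+
  qed
  then show ?thesis
    unfolding cont_curl_def whitney_face_eq_combine case_prod_beta by blast
qed

end

theorem lemma4p14:
  fixes T :: "(real^3) set" and n :: nat and v :: "nat \<Rightarrow> real^3"
    and lam :: "nat \<Rightarrow> real^3 \<Rightarrow> real" and C :: "nat \<Rightarrow> nat \<Rightarrow> nat \<Rightarrow> real"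
    and xs :: "real^3"
  assumes "polyhedron_vertices T n v"
    and "gbc T {1..n} v lam"
    and "assumption1 T n v lam"
    and "assumption2 T n v lam"
    and "diagonal_coeffs T n v C"
    and "xs \<in> interior T"
    and "inner_diagonals T n v = {} \<or>
      (\<exists>xc. \<forall>i\<in>{1..n}. cross3 (xc - v i) (\<Sum>j | (i, j) \<in> edges T n v. tau v i j) = 0)"
  shows "P1 T \<subseteq> M1 T n v lam C \<and> P2 T \<subseteq> M2 T n v lam C xs"
proof -
  interpret tri_par_polyhedron T n v
  proof
    show "polyhedron_vertices T n v"
      by (rule assms)
    show "(\<exists>i j k. ccw_order T n v f [i, j, k]) \<or>
      (\<exists>i j k l. ccw_order T n v f [i, j, k, l] \<and> tau v i j = tau v l k)" if "f \<in> faces T" for f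
      using assms(4) that unfolding assumption2_def Let_def by blast
  qed
  let ?V = "{1..n}"
  define G where "G i x = grad T (lam i) x" for i x
  have C1: "C1_on T (lam i)" if "i \<in> ?V" for i
    using assms(3) that unfolding assumption1_def by blast
  have grads: "(\<Sum>i\<in>?V. (q \<bullet> v i + b) *\<^sub>R G i x) = q" if "x \<in> T" for q b x
    unfolding G_def by (rule gbc_gradients[OF convex interior_ne assms(2) C1 that])
  have grad_lin: "(\<Sum>i\<in>?V. (q \<bullet> (v i - o')) *\<^sub>R G i x) = q" if "x \<in> T" for q o' x
    using grads[OF that, of q "- (q \<bullet> o')"] by (simp add: inner_diff_right)
  have grad_sum: "(\<Sum>i\<in>?V. G i x) = 0" if "x \<in> T" for x
    using grads[OF that, of 0 1] by simp
  have affine: "q \<bullet> x + b = (\<Sum>i\<in>?V. (q \<bullet> v i + b) * lam i x)" if "x \<in> T" for q b x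
    using assms(2) that unfolding gbc_def by blast
  have lam_sum: "(\<Sum>i\<in>?V. lam i x) = 1" if "x \<in> T" for x
    using affine[OF that, of 0 1] by simp
  have lam_lin: "(\<Sum>i\<in>?V. lam i x *\<^sub>R (v i - o')) = x - o'" if "x \<in> T" for x o'
  proof -
    have "q \<bullet> (\<Sum>i\<in>?V. lam i x *\<^sub>R (v i - o')) = q \<bullet> (x - o')" for q
      using affine[OF that, of q "- (q \<bullet> o')"] by (simp add: inner_sum_right inner_diff_right mult.commute)
    then show ?thesis
      using vector_eq_ldot by blast
  qed
  \<comment> \<open>The center for type II; for type I any point will do.\<close>
  obtain o' where type: "inner_diagonals T n v = {} \<or>
      (\<forall>i\<in>?V. cross3 (o' - v i) (\<Sum>j | (i, j) \<in> edges T n v. tau v i j) = 0)"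
    using assms(7) by blast
  let ?B = "\<lambda>a i k. a \<bullet> cross3 (v i - o') (v k - o')"
  define c where "c f x = (\<Sum>(i, j)\<in>face_bdry T n v f. combine T n v C (\<lambda>i j. 2 *\<^sub>R cross3 (G i x) (G j x)) i j)" for f x
  have curl_c: "has_curl T (whitney_face T n v lam C f) (c f)" for f
    using has_curl_whitney_face[of lam C f, OF C1] unfolding c_def G_def .
  \<comment> \<open>By cyclicity the weight is the linear function with gradient a x (v_i - o'),
    evaluated at \<open>v k - o'\<close>; the coordinate gradients reproduce that gradient.\<close>
  have contract: "(\<Sum>k\<in>?V. ?B a i k *\<^sub>R G k x) = cross3 a (v i - o')" if "x \<in> T" for a i x
  proof -
    have "?B a i k = cross3 a (v i - o') \<bullet> (v k - o')" for k
      by (metis cross_triple inner_commute)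
    then show ?thesis
      using grad_lin[OF that] by simp
  qed
  have rotation: "(\<Sum>i\<in>?V. \<Sum>k\<in>?V. ?B a i k *\<^sub>R whitney T lam i k x) = 2 *\<^sub>R cross3 a (x - o')"
    if x: "x \<in> T" for a x
  proof -
    have "linear (cross3 a)"
      by (rule linearI) (simp_all add: cross_add_right cross_mult_right)
    then have cross_lam: "(\<Sum>i\<in>?V. lam i x *\<^sub>R cross3 a (v i - o')) = cross3 a (x - o')"
      unfolding lam_lin[OF x, of o', symmetric] by (simp add: linear_sum linear_scale)
    have "(\<Sum>i\<in>?V. \<Sum>k\<in>?V. ?B a i k *\<^sub>R whitney T lam i k x) =
      (\<Sum>i\<in>?V. \<Sum>k\<in>?V. lam i x *\<^sub>R ?B a i k *\<^sub>R G k x) - (\<Sum>i\<in>?V. \<Sum>k\<in>?V. lam k x *\<^sub>R ?B a i k *\<^sub>R G i x)"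
      unfolding sum_subtractf[symmetric] by (simp add: whitney_def G_def scaleR_right_diff_distrib mult.commute)
    also have "(\<Sum>i\<in>?V. \<Sum>k\<in>?V. lam i x *\<^sub>R ?B a i k *\<^sub>R G k x) = cross3 a (x - o')"
      unfolding scaleR_right.sum[symmetric] contract[OF x] cross_lam ..
    also have "(\<Sum>i\<in>?V. \<Sum>k\<in>?V. lam k x *\<^sub>R ?B a i k *\<^sub>R G i x) = (\<Sum>k\<in>?V. \<Sum>i\<in>?V. - (lam k x *\<^sub>R ?B a k i *\<^sub>R G i x))"
    proof (subst sum.swap, intro sum.cong refl)
      fix i k
      show "lam k x *\<^sub>R ?B a i k *\<^sub>R G i x = - (lam k x *\<^sub>R ?B a k i *\<^sub>R G i x)"
        by (subst cross_skew) simp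
    qed
    also have "\<dots> = - cross3 a (x - o')"
      unfolding sum_negf scaleR_right.sum[symmetric] contract[OF x] cross_lam ..
    finally show ?thesis
      by (simp add: scaleR_2)
  qed
  have curl_rotation: "(\<Sum>i\<in>?V. \<Sum>k\<in>?V. ?B a i k *\<^sub>R 2 *\<^sub>R cross3 (G i x) (G k x)) = 4 *\<^sub>R a"
    if x: "x \<in> T" for a x
  proof -
    \<comment> \<open>The tensor products of the coordinate gradients with \<open>v i - o'\<close>
      sum to the identity. Its trace is 3 and its transpose fixes a, so the double sum is 2 (3 a -
      a) = 4 a.\<close>
    have "(\<Sum>i\<in>?V. G i x $ l * (v i - o') $ l) = 1" for l
    proof -
      have "(\<Sum>i\<in>?V. (axis l 1 \<bullet> (v i - o')) *\<^sub>R G i x) $ l = 1"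
        unfolding grad_lin[OF x] by (simp add: axis_def)
      then show ?thesis
        by (simp add: inner_axis' mult.commute)
    qed
    then have trace: "(\<Sum>i\<in>?V. G i x \<bullet> (v i - o')) = 3"
      unfolding inner_vec_def by (subst sum.swap) simp
    have transposed: "(\<Sum>i\<in>?V. (G i x \<bullet> a) *\<^sub>R (v i - o')) = a"
    proof -
      have "q \<bullet> (\<Sum>i\<in>?V. (G i x \<bullet> a) *\<^sub>R (v i - o')) = (\<Sum>i\<in>?V. (q \<bullet> (v i - o')) *\<^sub>R G i x) \<bullet> a" for q
        by (simp add: inner_sum_right inner_sum_left mult.commute)
      then show ?thesis
        unfolding grad_lin[OF x] using vector_eq_ldot by blast
    qed
    have "(\<Sum>k\<in>?V. ?B a i k *\<^sub>R 2 *\<^sub>R cross3 (G i x) (G k x)) =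
        2 *\<^sub>R ((G i x \<bullet> (v i - o')) *\<^sub>R a - (G i x \<bullet> a) *\<^sub>R (v i - o'))" for i
    proof -
      have lin: "linear (cross3 (G i x))"
        by (rule linearI) (simp_all add: cross_add_right cross_mult_right)
      have "(\<Sum>k\<in>?V. ?B a i k *\<^sub>R 2 *\<^sub>R cross3 (G i x) (G k x)) =
          2 *\<^sub>R cross3 (G i x) (\<Sum>k\<in>?V. ?B a i k *\<^sub>R G k x)"
        by (simp add: linear_sum[OF lin] linear_scale[OF lin] scaleR_right.sum mult.commute)
      then show ?thesis
        unfolding contract[OF x] Lagrange .
    qed
    then have "(\<Sum>i\<in>?V. \<Sum>k\<in>?V. ?B a i k *\<^sub>R 2 *\<^sub>R cross3 (G i x) (G k x)) =
        2 *\<^sub>R ((\<Sum>i\<in>?V. G i x \<bullet> (v i - o')) *\<^sub>R a - (\<Sum>i\<in>?V. (G i x \<bullet> a) *\<^sub>R (v i - o')))"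
      by (simp only: scaleR_right.sum[symmetric] sum_subtractf scaleR_sum_left)
    then show ?thesis
      unfolding trace transposed by (simp add: algebra_simps flip: scaleR_left_diff_distrib scaleR_add_left)
  qed
  have spanned: "\<exists>y p. (\<forall>x\<in>T. cross3 a x + b = (\<Sum>j\<in>?V. p j *\<^sub>R G j x) + (\<Sum>f\<in>faces T. y f *\<^sub>R whitney_face T n v lam C f x)) \<and>
      (\<forall>x\<in>T. 2 *\<^sub>R a = (\<Sum>f\<in>faces T. y f *\<^sub>R c f x))" for a b
  proof -
    obtain y p where yp: "\<And>W :: nat \<Rightarrow> nat \<Rightarrow> real^3. (\<forall>i j. W j i = - W i j) \<Longrightarrow>
      (\<Sum>i\<in>?V. \<Sum>k\<in>?V. ?B a i k *\<^sub>R W i k) =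
      2 *\<^sub>R (\<Sum>f\<in>faces T. y f *\<^sub>R (\<Sum>(i, j)\<in>face_bdry T n v f. combine T n v C W i j)) +
      2 *\<^sub>R (\<Sum>j\<in>?V. p j *\<^sub>R (\<Sum>i\<in>?V. W i j))"
      using rotation_chain_spanned[OF assms(5) type, of a] by blast
    \<comment> \<open>Moving the origin from o' to 0 leaves the constant a x o' + b. It is the
      gradient of a linear function, whose vertex values are added to the potential.\<close>
    have "cross3 a x + b = (\<Sum>j\<in>?V. (p j + (cross3 a o' + b) \<bullet> v j) *\<^sub>R G j x) +
        (\<Sum>f\<in>faces T. y f *\<^sub>R whitney_face T n v lam C f x)" if x: "x \<in> T" for x
    proof -
      have star: "(\<Sum>i\<in>?V. whitney T lam i j x) = G j x" for j
        using lam_sum[OF x] grad_sum[OF x]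
        by (simp add: whitney_def G_def sum_subtractf scaleR_sum_left[symmetric] scaleR_right.sum[symmetric])
      have "2 *\<^sub>R cross3 a (x - o') = 2 *\<^sub>R (\<Sum>f\<in>faces T. y f *\<^sub>R whitney_face T n v lam C f x) +
          2 *\<^sub>R (\<Sum>j\<in>?V. p j *\<^sub>R G j x)"
        unfolding rotation[OF x, symmetric] whitney_face_eq_combine star[symmetric]
        by (rule yp) (simp add: whitney_def)
      then have "2 *\<^sub>R cross3 a (x - o') = 2 *\<^sub>R ((\<Sum>f\<in>faces T. y f *\<^sub>R whitney_face T n v lam C f x) +
          (\<Sum>j\<in>?V. p j *\<^sub>R G j x))"
        by (simp only: scaleR_right_distrib)
      then have "cross3 a (x - o') = (\<Sum>f\<in>faces T. y f *\<^sub>R whitney_face T n v lam C f x) +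
          (\<Sum>j\<in>?V. p j *\<^sub>R G j x)"
        by simp
      moreover have "cross3 a o' + b = (\<Sum>j\<in>?V. ((cross3 a o' + b) \<bullet> v j) *\<^sub>R G j x)"
        using grads[OF x, of "cross3 a o' + b" 0] by simp
      moreover have "cross3 a x + b = cross3 a (x - o') + (cross3 a o' + b)"
        by (simp add: Cross3.right_diff_distrib)
      ultimately show ?thesis
        by (simp only: scaleR_left_distrib sum.distrib ac_simps)
    qed
    moreover have "2 *\<^sub>R a = (\<Sum>f\<in>faces T. y f *\<^sub>R c f x)" if x: "x \<in> T" for x
    proof -
      \<comment> \<open>The potential part drops out of the curls because the coordinate gradients
        sum to zero.\<close>
      have "(\<Sum>i\<in>?V. 2 *\<^sub>R cross3 (G i x) (G j x)) = 0" for j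
      proof -
        have "(\<Sum>i\<in>?V. 2 *\<^sub>R cross3 (G i x) (G j x)) = - (2 *\<^sub>R cross3 (G j x) (\<Sum>i\<in>?V. G i x))"
        proof -
          have lin: "linear (cross3 (G j x))"
            by (rule linearI) (simp_all add: cross_add_right cross_mult_right)
          show ?thesis
            unfolding linear_sum[OF lin] scaleR_right.sum sum_negf[symmetric]
            by (subst cross_skew) simp
        qed
        then show ?thesis
          using grad_sum[OF x] by simp
      qed
      moreover have "\<forall>i j. 2 *\<^sub>R cross3 (G j x) (G i x) = - (2 *\<^sub>R cross3 (G i x) (G j x))"
        by (metis cross_skew scaleR_minus_right)
      from yp[OF this] have "4 *\<^sub>R a = 2 *\<^sub>R (\<Sum>f\<in>faces T. y f *\<^sub>R c f x) +
          2 *\<^sub>R (\<Sum>j\<in>?V. p j *\<^sub>R (\<Sum>i\<in>?V. 2 *\<^sub>R cross3 (G i x) (G j x)))"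
        unfolding curl_rotation[OF x] c_def .
      ultimately have "4 *\<^sub>R a = 2 *\<^sub>R (\<Sum>f\<in>faces T. y f *\<^sub>R c f x)"
        by simp
      then have "(1/2) *\<^sub>R 4 *\<^sub>R a = (1/2) *\<^sub>R 2 *\<^sub>R (\<Sum>f\<in>faces T. y f *\<^sub>R c f x)"
        by simp
      then show ?thesis by simp
    qed
    ultimately show ?thesis
      by (intro exI[of _ y] exI[of _ "\<lambda>j. p j + (cross3 a o' + b) \<bullet> v j"]) simp
  qed
  have "on_set T (\<lambda>x. cross3 a x + b) \<in> M1 T n v lam C" for a b
  proof -
    obtain y p where yp: "\<And>x. x \<in> T \<Longrightarrow> cross3 a x + b =
        (\<Sum>j\<in>?V. p j *\<^sub>R G j x) + (\<Sum>f\<in>faces T. y f *\<^sub>R whitney_face T n v lam C f x)"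
      using spanned[of a b] by blast
    have "on_set T (\<lambda>x. cross3 a x + b) =
        (\<lambda>x. \<Sum>j\<in>?V. p j *\<^sub>R on_set T (grad T (lam j)) x) +
        (\<lambda>x. \<Sum>f\<in>faces T. y f *\<^sub>R on_set T (whitney_face T n v lam C f) x)"
      using yp by (auto simp: fun_eq_iff on_set_def G_def)
    moreover have "(\<lambda>x. \<Sum>j\<in>?V. p j *\<^sub>R on_set T (grad T (lam j)) x) \<in>
        fields.span {on_set T (grad T (lam i)) | i. i \<in> ?V}"
      by (rule span_combination) blast
    moreover have "(\<lambda>x. \<Sum>f\<in>faces T. y f *\<^sub>R on_set T (whitney_face T n v lam C f) x) \<in>
        fields.span {on_set T (whitney_face T n v lam C f) | f. f \<in> faces T}"
      by (rule span_combination) blast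
    ultimately show ?thesis
      unfolding M1_def by blast
  qed
  moreover have "on_set T (\<lambda>x. s *\<^sub>R x + d) \<in> M2 T n v lam C xs" for s d
  proof -
    \<comment> \<open>Splitting s (x - xs) off s x + d leaves the constant d + s xs. The curls in
      \<open>spanned\<close> give twice its argument, hence the factor 1/2.\<close>
    obtain y where y: "\<And>x. x \<in> T \<Longrightarrow> d + s *\<^sub>R xs = (\<Sum>f\<in>faces T. y f *\<^sub>R c f x)"
      using spanned[of "(1/2) *\<^sub>R (d + s *\<^sub>R xs)" 0] by auto
    have "s *\<^sub>R x + d = (\<Sum>f\<in>faces T. y f *\<^sub>R c f x) + s *\<^sub>R (x - xs)" if "x \<in> T" for x
      using y[OF that] by (simp add: algebra_simps)
    then have "on_set T (\<lambda>x. s *\<^sub>R x + d) =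
        (\<lambda>x. \<Sum>f\<in>faces T. y f *\<^sub>R on_set T (c f) x) + (\<lambda>x. s *\<^sub>R on_set T (\<lambda>x. x - xs) x)"
      by (auto simp: fun_eq_iff on_set_def)
    moreover have "(\<lambda>x. \<Sum>f\<in>faces T. y f *\<^sub>R on_set T (c f) x) \<in>
        fields.span {on_set T c | c f. f \<in> faces T \<and> has_curl T (whitney_face T n v lam C f) c}"
      using curl_c by (intro span_combination) blast
    moreover have "(\<lambda>x. s *\<^sub>R on_set T (\<lambda>x. x - xs) x) \<in> fields.span {on_set T (\<lambda>x. x - xs)}"
      by (intro fields.span_scale fields.span_base) simp
    ultimately show ?thesis
      unfolding M2_def by blast
  qed
  ultimately show ?thesis
    unfolding P1_def P2_def by blast
qed

end
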